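(* Let $(\varphi_n)_{n\in\mathbb N}$ be a sequence of Young functions such that $\varphi_{j+1}(t)\le \varphi_j(t)$ and $\sum_{n=1}^\infty \varphi_n(t)=+\infty$ for each $t>0$ and $j\in\mathbb N$. Let $k\colon[0,1]\times[0,1]\to\mathbb R$ be a kernel such that for every $t\in[0,1]$ the function $s\mapsto k(t,s)$ is Lebesgue integrable on $[0,1]$, and let $K$ be the linear integral operator given by $$(Kx)(t)=\int_0^1 k(t,s)x(s)\,ds,\qquad t\in[0,1],\ x\in BV[0,1]$$ (Lebesgue integral). Then $K$ maps $BV[0,1]$ into $\Phi BV[0,1]$ and is compact if and only if for every $\varepsilon>0$ there exists $\delta=\delta(\varepsilon)>0$ such that $$\operatorname{var}_\Phi\Bigl(\varepsilon^{-1}\cdot\int_a^b k(\cdot,s)\,ds\Bigr)\le 1$$ for any subinterval $[a,b]$ of $[0,1]$ of length not exceeding $\delta$, where $\int_a^b k(\cdot,s)\,ds$ denotes the function $t\mapsto\int_a^b k(t,s)\,ds$ on $[0,1]$.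
   Context: A Young function is a convex function $\varphi\colon[0,+\infty)\to[0,+\infty)$ such that $\varphi(t)=0$ if and only if $t=0$. Closed intervals may be degenerate (a single point). Two intervals are non-overlapping if their intersection is empty or a singleton; a collection is non-overlapping if its members are pairwise so, and the intervals in a collection are assumed distinct. For a function $x$ and an interval $I=[a,b]$ write $x(I):=x(b)-x(a)$. For a sequence $(\varphi_n)$ of Young functions with $\varphi_{j+1}\le\varphi_j$ and $\sum_n\varphi_n(t)=+\infty$ for $t>0$, the Schramm variation of $x\colon[0,1]\to\mathbb R$ is $$\operatorname{var}_\Phi x:=\sup\sum_{n=1}^{m}\varphi_n(|x(I_n)|)\in[0,+\infty],$$ where the supremum is over all finite collections $I_1,\dots,I_m$ ($m\in\mathbb N$, in any order) of closed non-overlapping subintervals of $[0,1]$. The Jordan variation $\operatorname{var}x$ is the case $\varphi_n(t)=t$ for all $n$. $\Phi BV[0,1]$ is the linear space of all $x\colon[0,1]\to\mathbb R$ such that $\operatorname{var}_\Phi(\lambda x)<+\infty$ for some $\lambda>0$; it is a Banach space with norm $\|x\|_\Phi:=|x(0)|+|x|_\Phi$, where $|x|_\Phi:=\inf\{\lambda>0 : \operatorname{var}_\Phi(\lambda^{-1}x)\le1\}$. $BV[0,1]$ is the linear space of all $x\colon[0,1]\to\mathbb R$ with $\operatorname{var}x<+\infty$, a Banach space with norm $\|x\|_{BV}:=|x(0)|+\operatorname{var}x$. $K\colon BV[0,1]\to\Phi BV[0,1]$ is compact if the image of the closed unit ball of $(BV[0,1],\|\cdot\|_{BV})$ is a relatively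 compact subset of $(\Phi BV[0,1],\|\cdot\|_\Phi)$, i.e. has compact closure. *)

theory Defs
  imports "HOL-Analysis.Analysis"
begin

definition young_function :: "(real \<Rightarrow> real) \<Rightarrow> bool" where
  "young_function f \<longleftrightarrow>
     convex_on {0..} f \<and> (\<forall>t\<ge>0. f t \<ge> 0) \<and> (\<forall>t\<ge>0. f t = 0 \<longleftrightarrow> t = 0)"

text \<open>Sequences indexed by the positive integers are indexed from 0 here.\<close>

definition schramm_sequence :: "(nat \<Rightarrow> real \<Rightarrow> real) \<Rightarrow> bool" where
  "schramm_sequence \<phi> \<longleftrightarrow>
     (\<forall>n. young_function (\<phi> n)) \<and>
     (\<forall>j. \<forall>t>0. \<phi> (Suc j) t \<le> \<phi> j t) \<and>
     (\<forall>t>0. (\<Sum>n. ennreal (\<phi> n t)) = \<infinity>)"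

definition non_overlapping :: "real set \<Rightarrow> real set \<Rightarrow> bool" where
  "non_overlapping I J \<longleftrightarrow> I \<inter> J = {} \<or> is_singleton (I \<inter> J)"

text \<open>A closed interval is given by the pair of its endpoints, and a finite collection
  \<open>I\<^sub>1, \<dots>, I\<^sub>m\<close> listed in some order by a list without repetitions. Degenerate intervals are allowed.\<close>

definition interval_collections :: "(real \<times> real) list set" where
  "interval_collections =
     {Is. distinct Is \<and>
          (\<forall>(a, b)\<in>set Is. 0 \<le> a \<and> a \<le> b \<and> b \<le> 1) \<and>
          pairwise (\<lambda>(a, b) (c, d). non_overlapping {a..b} {c..d}) (set Is)}"

definition schramm_var :: "(nat \<Rightarrow> real \<Rightarrow> real) \<Rightarrow> (real \<Rightarrow> real) \<Rightarrow> ennreal" where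
  "schramm_var \<phi> x =
     (SUP Is\<in>interval_collections.
        \<Sum>n<length Is. ennreal (\<phi> n \<bar>x (snd (Is ! n)) - x (fst (Is ! n))\<bar>))"

definition jordan_var :: "(real \<Rightarrow> real) \<Rightarrow> ennreal" where
  "jordan_var = schramm_var (\<lambda>n t. t)"

text \<open>Functions on \<open>[0,1]\<close> are represented by the members of \<^term>\<open>extensional {0..1::real}\<close>, so that two
  of them agreeing on \<open>[0,1]\<close> are equal; otherwise the norms below would not separate points.\<close>

definition BV :: "(real \<Rightarrow> real) set" where
  "BV = {x \<in> extensional {0..1}. jordan_var x < \<infinity>}"

definition BV_norm :: "(real \<Rightarrow> real) \<Rightarrow> real" where
  "BV_norm x = \<bar>x 0\<bar> + enn2real (jordan_var x)"

definition PhiBV :: "(nat \<Rightarrow> real \<Rightarrow> real) \<Rightarrow> (real \<Rightarrow> real) set" where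
  "PhiBV \<phi> = {x \<in> extensional {0..1}. \<exists>l>0. schramm_var \<phi> (\<lambda>t. l * x t) < \<infinity>}"

definition PhiBV_seminorm :: "(nat \<Rightarrow> real \<Rightarrow> real) \<Rightarrow> (real \<Rightarrow> real) \<Rightarrow> real" where
  "PhiBV_seminorm \<phi> x = Inf {l. l > 0 \<and> schramm_var \<phi> (\<lambda>t. inverse l * x t) \<le> 1}"

definition PhiBV_norm :: "(nat \<Rightarrow> real \<Rightarrow> real) \<Rightarrow> (real \<Rightarrow> real) \<Rightarrow> real" where
  "PhiBV_norm \<phi> x = \<bar>x 0\<bar> + PhiBV_seminorm \<phi> x"

definition PhiBV_dist :: "(nat \<Rightarrow> real \<Rightarrow> real) \<Rightarrow> (real \<Rightarrow> real) \<Rightarrow> (real \<Rightarrow> real) \<Rightarrow> real" where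
  "PhiBV_dist \<phi> x y = (if x \<in> PhiBV \<phi> \<and> y \<in> PhiBV \<phi> then PhiBV_norm \<phi> (\<lambda>t. x t - y t) else 0)"

text \<open>The locale \<^locale>\<open>Metric_space\<close> asks for \<open>d x y \<ge> 0\<close> also off the carrier, where the
  infimum in the seminorm may be over the empty set; hence the value 0 there.
  \<open>Metric_space_PhiBV\<close> below shows that this is the topology of a genuine metric space.\<close>

definition PhiBV_topology :: "(nat \<Rightarrow> real \<Rightarrow> real) \<Rightarrow> (real \<Rightarrow> real) topology" where
  "PhiBV_topology \<phi> = Metric_space.mtopology (PhiBV \<phi>) (PhiBV_dist \<phi>)"

definition compact_operator ::
    "(nat \<Rightarrow> real \<Rightarrow> real) \<Rightarrow> ((real \<Rightarrow> real) \<Rightarrow> real \<Rightarrow> real) \<Rightarrow> bool" where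
  "compact_operator \<phi> T \<longleftrightarrow>
     compactin (PhiBV_topology \<phi>) (PhiBV_topology \<phi> closure_of (T ` {x \<in> BV. BV_norm x \<le> 1}))"

definition integral_operator ::
    "(real \<Rightarrow> real \<Rightarrow> real) \<Rightarrow> (real \<Rightarrow> real) \<Rightarrow> real \<Rightarrow> real" where
  "integral_operator k x = (\<lambda>t\<in>{0..1}. LINT s:{0..1}|lebesgue. k t s * x s)"


lemma young_mono:
  assumes "young_function f" "0 \<le> s" "s \<le> t"
  shows "f s \<le> f t"
proof (cases "t = 0")
  case False
  have c: "convex_on {0..} f" and n: "f t \<ge> 0" "f 0 = 0"
    using assms unfolding young_function_def by auto
  have "f ((1 - s/t) *\<^sub>R 0 + (s/t) *\<^sub>R t) \<le> (1 - s/t) * f 0 + (s/t) * f t"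
    using c by (rule convex_onD) (use assms False in \<open>auto simp: divide_simps\<close>)
  also have "\<dots> \<le> 1 * f t"
    using n assms False by (simp only: mult_zero_right add_0_left) (intro mult_right_mono, auto)
  finally show ?thesis using False by simp
qed (use assms in auto)

lemma young_comb:
  assumes f: "young_function f" and uv: "u \<ge> 0" "v \<ge> 0" "u + v = (1::real)"
  shows "f \<bar>u * p + v * q\<bar> \<le> u * f \<bar>p\<bar> + v * f \<bar>q\<bar>"
proof -
  have "\<bar>u * p + v * q\<bar> \<le> u * \<bar>p\<bar> + v * \<bar>q\<bar>"
    using uv by (metis abs_mult abs_of_nonneg abs_triangle_ineq)
  hence "f \<bar>u * p + v * q\<bar> \<le> f (u * \<bar>p\<bar> + v * \<bar>q\<bar>)"
    by (intro young_mono[OF f]) auto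
  also have "\<dots> = f ((1 - v) *\<^sub>R \<bar>p\<bar> + v *\<^sub>R \<bar>q\<bar>)"
  proof -
    have "u = 1 - v" using uv by simp
    thus ?thesis by simp
  qed
  also have "\<dots> \<le> (1 - v) * f \<bar>p\<bar> + v * f \<bar>q\<bar>"
    by (rule convex_onD) (use f uv in \<open>auto simp: young_function_def\<close>)
  also have "1 - v = u" using uv by simp
  finally show ?thesis .
qed

lemma schramm_var_minus: "schramm_var \<phi> (\<lambda>t. - x t) = schramm_var \<phi> x"
  unfolding schramm_var_def by (simp add: abs_minus_commute)

lemma schramm_var_const:
  assumes "schramm_sequence \<phi>"
  shows "schramm_var \<phi> (\<lambda>t. c) = 0"
proof -
  have "\<phi> n 0 = 0" for n
    using assms unfolding schramm_sequence_def young_function_def by auto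
  moreover have "[] \<in> interval_collections" unfolding interval_collections_def by auto
  ultimately show ?thesis unfolding schramm_var_def by (auto intro!: antisym SUP_least)
qed

lemma schramm_var_comb:
  assumes S: "schramm_sequence \<phi>" and uv: "u \<ge> 0" "v \<ge> 0" "u + v = (1::real)"
  shows "schramm_var \<phi> (\<lambda>t. u * x t + v * y t) \<le>
         ennreal u * schramm_var \<phi> x + ennreal v * schramm_var \<phi> y"
proof -
  let ?s = "\<lambda>z Is. \<Sum>n<length Is. ennreal (\<phi> n \<bar>z (snd (Is ! n)) - z (fst (Is ! n))\<bar>)"
  have Y: "young_function (\<phi> n)" for n using S unfolding schramm_sequence_def by auto
  have nn: "\<phi> n \<bar>a\<bar> \<ge> 0" for n a using Y unfolding young_function_def by auto
  have "?s (\<lambda>t. u * x t + v * y t) Is \<le> ennreal u * schramm_var \<phi> x + ennreal v * schramm_var \<phi> y"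
    if I: "Is \<in> interval_collections" for Is
  proof -
    have "?s (\<lambda>t. u * x t + v * y t) Is \<le> ennreal u * ?s x Is + ennreal v * ?s y Is"
      unfolding sum_distrib_left sum.distrib[symmetric]
    proof (rule sum_mono)
      fix n
      let ?p = "x (snd (Is ! n)) - x (fst (Is ! n))" and ?q = "y (snd (Is ! n)) - y (fst (Is ! n))"
      have "\<phi> n \<bar>u * ?p + v * ?q\<bar> \<le> u * \<phi> n \<bar>?p\<bar> + v * \<phi> n \<bar>?q\<bar>"
        by (rule young_comb[OF Y uv])
      moreover have "u * ?p + v * ?q = u * x (snd (Is ! n)) + v * y (snd (Is ! n)) -
                        (u * x (fst (Is ! n)) + v * y (fst (Is ! n)))"
        by (simp add: algebra_simps)
      ultimately show "ennreal (\<phi> n \<bar>u * x (snd (Is ! n)) + v * y (snd (Is ! n)) -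
                        (u * x (fst (Is ! n)) + v * y (fst (Is ! n)))\<bar>)
            \<le> ennreal u * ennreal (\<phi> n \<bar>?p\<bar>) + ennreal v * ennreal (\<phi> n \<bar>?q\<bar>)"
        using uv nn by (simp add: ennreal_mult[symmetric] ennreal_plus[symmetric] del: ennreal_plus)
    qed
    also have "\<dots> \<le> ennreal u * schramm_var \<phi> x + ennreal v * schramm_var \<phi> y"
      using I unfolding schramm_var_def by (intro add_mono mult_left_mono SUP_upper) auto
    finally show ?thesis .
  qed
  thus ?thesis unfolding schramm_var_def[of \<phi> "\<lambda>t. u * x t + v * y t"] by (rule SUP_least)
qed

definition PhiBV_levels :: "(nat \<Rightarrow> real \<Rightarrow> real) \<Rightarrow> (real \<Rightarrow> real) \<Rightarrow> real set" where
  "PhiBV_levels \<phi> x = {l. l > 0 \<and> schramm_var \<phi> (\<lambda>t. inverse l * x t) \<le> 1}"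

lemma PhiBV_levels_minus: "PhiBV_levels \<phi> (\<lambda>t. - x t) = PhiBV_levels \<phi> x"
  unfolding PhiBV_levels_def using schramm_var_minus[of \<phi> "\<lambda>t. inverse l * x t" for l] by simp

lemma PhiBV_levels_add:
  assumes S: "schramm_sequence \<phi>" and "l \<in> PhiBV_levels \<phi> x" "m \<in> PhiBV_levels \<phi> y"
  shows "l + m \<in> PhiBV_levels \<phi> (\<lambda>t. x t + y t)"
proof -
  have lm: "l > 0" "m > 0" using assms unfolding PhiBV_levels_def by auto
  let ?u = "l / (l + m)" and ?v = "m / (l + m)"
  have uv: "?u \<ge> 0" "?v \<ge> 0" "?u + ?v = 1" using lm by (auto simp: add_divide_distrib[symmetric])
  have "(\<lambda>t. inverse (l + m) * (x t + y t)) =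
        (\<lambda>t. ?u * (inverse l * x t) + ?v * (inverse m * y t))"
  proof
    fix t
    have "?u * (inverse l * x t) = inverse (l + m) * x t" "?v * (inverse m * y t) = inverse (l + m) * y t"
      using lm by (simp_all add: field_simps)
    thus "inverse (l + m) * (x t + y t) = ?u * (inverse l * x t) + ?v * (inverse m * y t)"
      by (simp only: distrib_left)
  qed
  hence "schramm_var \<phi> (\<lambda>t. inverse (l + m) * (x t + y t)) \<le>
      ennreal ?u * schramm_var \<phi> (\<lambda>t. inverse l * x t) + ennreal ?v * schramm_var \<phi> (\<lambda>t. inverse m * y t)"
    using schramm_var_comb[OF S uv] by simp
  also have "\<dots> \<le> ennreal ?u * 1 + ennreal ?v * 1"
    using assms unfolding PhiBV_levels_def by (intro add_mono mult_left_mono) auto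
  also have "\<dots> = 1" using uv by (simp add: ennreal_plus[symmetric] del: ennreal_plus)
  finally show ?thesis using lm unfolding PhiBV_levels_def by simp
qed

lemma PhiBV_levels_nonempty:
  assumes S: "schramm_sequence \<phi>" and x: "x \<in> PhiBV \<phi>"
  shows "PhiBV_levels \<phi> x \<noteq> {}"
proof -
  obtain l where l: "l > 0" "schramm_var \<phi> (\<lambda>t. l * x t) < \<infinity>"
    using x unfolding PhiBV_def by auto
  then obtain c where c: "c \<ge> 0" "schramm_var \<phi> (\<lambda>t. l * x t) = ennreal c"
    by (cases "schramm_var \<phi> (\<lambda>t. l * x t)") auto
  let ?u = "1 / max 1 c"
  have u: "?u \<ge> 0" "1 - ?u \<ge> 0" "?u + (1 - ?u) = 1" by auto
  have "schramm_var \<phi> (\<lambda>t. ?u * (l * x t) + (1 - ?u) * 0) \<le> ennreal ?u * ennreal c + ennreal (1 - ?u) * 0"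
    using schramm_var_comb[OF S u, of "\<lambda>t. l * x t" "\<lambda>t. 0"] c schramm_var_const[OF S] by simp
  also have "\<dots> = ennreal (?u * c)" using c u by (simp only: ennreal_mult mult_zero_right add_0_right)
  also have "\<dots> \<le> 1" using c by (auto simp: max_def divide_simps)
  finally have "max 1 c / l \<in> PhiBV_levels \<phi> x"
    using l unfolding PhiBV_levels_def by (simp add: mult.assoc)
  thus ?thesis by auto
qed

lemma Inf_PhiBV_levels_ge_0: "PhiBV_levels \<phi> x \<noteq> {} \<Longrightarrow> Inf (PhiBV_levels \<phi> x) \<ge> 0"
  by (rule cInf_greatest) (auto simp: PhiBV_levels_def)

lemma Inf_PhiBV_levels_add:
  assumes S: "schramm_sequence \<phi>" and ne: "PhiBV_levels \<phi> x \<noteq> {}" "PhiBV_levels \<phi> y \<noteq> {}"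
  shows "Inf (PhiBV_levels \<phi> (\<lambda>t. x t + y t)) \<le> Inf (PhiBV_levels \<phi> x) + Inf (PhiBV_levels \<phi> y)"
proof -
  have b: "bdd_below (PhiBV_levels \<phi> z)" for z
    by (rule bdd_belowI[of _ 0]) (auto simp: PhiBV_levels_def)
  have 1: "Inf (PhiBV_levels \<phi> (\<lambda>t. x t + y t)) \<le> l + m"
    if "l \<in> PhiBV_levels \<phi> x" "m \<in> PhiBV_levels \<phi> y" for l m
    by (rule cInf_lower[OF PhiBV_levels_add[OF S that] b])
  have "Inf (PhiBV_levels \<phi> (\<lambda>t. x t + y t)) - m \<le> Inf (PhiBV_levels \<phi> x)"
    if "m \<in> PhiBV_levels \<phi> y" for m
    by (rule cInf_greatest[OF ne(1)]) (use 1 that in force)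
  hence "Inf (PhiBV_levels \<phi> (\<lambda>t. x t + y t)) - Inf (PhiBV_levels \<phi> x) \<le> Inf (PhiBV_levels \<phi> y)"
    by (intro cInf_greatest[OF ne(2)]) force
  thus ?thesis by simp
qed

lemma Inf_PhiBV_levels_const:
  assumes "schramm_sequence \<phi>"
  shows "Inf (PhiBV_levels \<phi> (\<lambda>t. c)) = 0"
proof -
  have "PhiBV_levels \<phi> (\<lambda>t. c) = {0<..}"
    unfolding PhiBV_levels_def by (auto simp: schramm_var_const[OF assms])
  thus ?thesis by simp
qed

lemma Inf_PhiBV_levels_eq_0D:
  assumes S: "schramm_sequence \<phi>" and ne: "PhiBV_levels \<phi> x \<noteq> {}"
    and I: "Inf (PhiBV_levels \<phi> x) = 0" and t: "t \<in> {0..1}"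
  shows "x t = x 0"
proof (rule ccontr)
  assume neq: "x t \<noteq> x 0"
  define d where "d = \<bar>x t - x 0\<bar>"
  have d: "d > 0" using neq by (auto simp: d_def)
  have Y: "young_function (\<phi> 0)" using S unfolding schramm_sequence_def by auto
  have pos: "\<phi> 0 d > 0" using Y d unfolding young_function_def by (metis less_eq_real_def order_less_irrefl)
  obtain l where l: "l \<in> PhiBV_levels \<phi> x" "l < min 1 (\<phi> 0 d)"
    using cInf_lessD[OF ne, of "min 1 (\<phi> 0 d)"] I pos by auto
  hence l0: "l > 0" "l < 1" "l < \<phi> 0 d" unfolding PhiBV_levels_def by auto
  have mem: "[(0, t)] \<in> interval_collections" using t unfolding interval_collections_def by auto
  have "ennreal (\<phi> 0 \<bar>inverse l * x t - inverse l * x 0\<bar>) \<le> schramm_var \<phi> (\<lambda>t. inverse l * x t)"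
    unfolding schramm_var_def by (rule SUP_upper2[OF mem]) simp
  also have "\<dots> \<le> 1" using l unfolding PhiBV_levels_def by auto
  finally have "\<phi> 0 \<bar>inverse l * x t - inverse l * x 0\<bar> \<le> 1" by simp
  moreover have "\<bar>inverse l * x t - inverse l * x 0\<bar> = inverse l * d"
    using l0 unfolding d_def by (simp add: abs_mult right_diff_distrib[symmetric])
  ultimately have le1: "\<phi> 0 (inverse l * d) \<le> 1" by simp
  have "\<phi> 0 \<bar>l * (inverse l * d) + (1 - l) * 0\<bar> \<le> l * \<phi> 0 \<bar>inverse l * d\<bar> + (1 - l) * \<phi> 0 \<bar>0\<bar>"
    by (rule young_comb[OF Y]) (use l0 in auto)
  moreover have "l * (inverse l * d) = d" using l0 by simp
  moreover have "\<phi> 0 0 = 0" using Y by (simp add: young_function_def)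
  ultimately have "\<phi> 0 d \<le> l * \<phi> 0 (inverse l * d)" using l0 d by (simp del: mult.left_commute)
  also have "\<dots> \<le> l * 1" using le1 l0 by (intro mult_left_mono) auto
  finally show False using l0 by simp
qed

lemma Metric_space_PhiBV:
  assumes S: "schramm_sequence \<phi>"
  shows "Metric_space (PhiBV \<phi>) (PhiBV_dist \<phi>)"
proof -
  have D: "PhiBV_dist \<phi> x y = \<bar>x 0 - y 0\<bar> + Inf (PhiBV_levels \<phi> (\<lambda>t. x t - y t))"
    if "x \<in> PhiBV \<phi>" "y \<in> PhiBV \<phi>" for x y
    using that unfolding PhiBV_dist_def PhiBV_norm_def PhiBV_seminorm_def PhiBV_levels_def by simp
  have ne: "PhiBV_levels \<phi> (\<lambda>t. x t - y t) \<noteq> {}" if "x \<in> PhiBV \<phi>" "y \<in> PhiBV \<phi>" for x y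
  proof -
    have "PhiBV_levels \<phi> x \<noteq> {}" "PhiBV_levels \<phi> (\<lambda>t. - y t) \<noteq> {}"
      unfolding PhiBV_levels_minus using PhiBV_levels_nonempty[OF S] that by auto
    then obtain l m where "l \<in> PhiBV_levels \<phi> x" "m \<in> PhiBV_levels \<phi> (\<lambda>t. - y t)"
      by blast
    from PhiBV_levels_add[OF S this] show ?thesis by auto
  qed
  have sym: "PhiBV_dist \<phi> x y = PhiBV_dist \<phi> y x" for x y
    using D[of x y] D[of y x] PhiBV_levels_minus[of \<phi> "\<lambda>t. x t - y t"]
    by (cases "x \<in> PhiBV \<phi> \<and> y \<in> PhiBV \<phi>") (auto simp: PhiBV_dist_def abs_minus_commute)
  have nonneg: "PhiBV_dist \<phi> x y \<ge> 0" for x y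
    using D[of x y] Inf_PhiBV_levels_ge_0[OF ne[of x y]]
    by (cases "x \<in> PhiBV \<phi> \<and> y \<in> PhiBV \<phi>") (auto simp: PhiBV_dist_def)
  show ?thesis
  proof
    fix x y
    show "0 \<le> PhiBV_dist \<phi> x y"
      by (rule nonneg)
    show "PhiBV_dist \<phi> x y = PhiBV_dist \<phi> y x" by (rule sym)
  next
    fix x y assume xy: "x \<in> PhiBV \<phi>" "y \<in> PhiBV \<phi>"
    show "PhiBV_dist \<phi> x y = 0 \<longleftrightarrow> x = y"
    proof
      assume "PhiBV_dist \<phi> x y = 0"
      hence z: "x 0 - y 0 = 0" "Inf (PhiBV_levels \<phi> (\<lambda>t. x t - y t)) = 0"
        using Inf_PhiBV_levels_ge_0[OF ne[OF xy]] unfolding D[OF xy] by auto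
      have "x t = y t" if "t \<in> {0..1}" for t
        using Inf_PhiBV_levels_eq_0D[OF S ne[OF xy] z(2) that] z(1) by simp
      thus "x = y" using xy unfolding PhiBV_def by (auto intro: extensionalityI[of _ "{0..1}"])
    next
      assume "x = y"
      thus "PhiBV_dist \<phi> x y = 0" using D[OF xy] Inf_PhiBV_levels_const[OF S, of 0] by simp
    qed
  next
    fix x y z assume xyz: "x \<in> PhiBV \<phi>" "y \<in> PhiBV \<phi>" "z \<in> PhiBV \<phi>"
    have "Inf (PhiBV_levels \<phi> (\<lambda>t. x t - z t)) \<le>
          Inf (PhiBV_levels \<phi> (\<lambda>t. x t - y t)) + Inf (PhiBV_levels \<phi> (\<lambda>t. y t - z t))"
      using Inf_PhiBV_levels_add[OF S ne[OF xyz(1,2)] ne[OF xyz(2,3)]] by simp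
    thus "PhiBV_dist \<phi> x z \<le> PhiBV_dist \<phi> x y + PhiBV_dist \<phi> y z"
      unfolding D[OF xyz(1,2)] D[OF xyz(2,3)] D[OF xyz(1,3)] by simp
  qed
qed

end

theory Submission
  imports Defs
begin

text \<open>Write \<open>K \<one>\<^sub>A\<close> for the function \<open>t \<mapsto> \<integral>\<^sub>A k t\<close>; the criterion says that \<open>K \<one>\<^sub>A\<close> is small for all
  short intervals \<open>A\<close>. If \<open>K\<close> is compact and the criterion fails, take intervals \<open>A\<close> of lengths tending to
  0 with \<open>K \<one>\<^sub>A\<close> bounded away from 0. By compactness a subsequence of these functions converges in the norm,
  hence pointwise, and the pointwise limit is 0: a contradiction.

  Conversely, let \<open>\<nu>\<close> round down to multiples of \<open>1 / N\<close>. For a monotone \<open>g\<close> with values in \<open>{0..1}\<close>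
  the function \<open>g - g \<circ> \<nu>\<close> is a uniform limit of averages of indicators of intervals of length at most
  \<open>1 / N\<close>, so \<open>K (g - g \<circ> \<nu>)\<close> is small because balls are convex and closed under pointwise limits. By
  Jordan decomposition \<open>K\<close> is uniformly close on the unit ball to the finite-rank operator \<open>x \<mapsto> K (x \<circ> \<nu>)\<close>,
  so the image of the ball is totally bounded; the target space is complete.\<close>

subsection \<open>Balls of the norm on bounded Schramm variation\<close>

text \<open>Balls for the larger of \<open>\<bar>f 0\<bar>\<close> and the seminorm, of functions that need not be extensional.
  Quantifying over \<open>l > c\<close> avoids the question whether the infimum in the seminorm is attained and
  admits \<open>c = 0\<close>.\<close>

definition PhiBV_cball :: "(nat \<Rightarrow> real \<Rightarrow> real) \<Rightarrow> real \<Rightarrow> (real \<Rightarrow> real) set" where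
  "PhiBV_cball \<phi> c = {f. \<bar>f 0\<bar> \<le> c \<and> (\<forall>l>c. l \<in> PhiBV_levels \<phi> f)}"

lemma PhiBV_cball_nonneg: "f \<in> PhiBV_cball \<phi> c \<Longrightarrow> 0 \<le> c"
  unfolding PhiBV_cball_def by auto

section \<open>Schramm variation on [0,1] and the algebra of the balls\<close>

lemma interval_collections_endpoints:
  assumes "Is \<in> interval_collections" "n < length Is"
  shows "0 \<le> fst (Is ! n)" "fst (Is ! n) \<le> snd (Is ! n)" "snd (Is ! n) \<le> 1"
proof -
  have "\<forall>(a, b)\<in>set Is. 0 \<le> a \<and> a \<le> b \<and> b \<le> 1"
    using assms(1) unfolding interval_collections_def by blast
  from bspec[OF this nth_mem[OF assms(2)]]
  show "0 \<le> fst (Is ! n)" "fst (Is ! n) \<le> snd (Is ! n)" "snd (Is ! n) \<le> 1"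
    by (simp_all add: split_beta)
qed

lemma schramm_var_cong:
  assumes "\<And>t. t \<in> {0..1} \<Longrightarrow> f t = g t"
  shows "schramm_var \<phi> f = schramm_var \<phi> g"
  unfolding schramm_var_def
proof (intro SUP_cong refl sum.cong)
  fix Is n
  assume "Is \<in> interval_collections" and "n \<in> {..<length Is}"
  then have "fst (Is ! n) \<in> {0..1}" "snd (Is ! n) \<in> {0..1}"
    using interval_collections_endpoints[of Is n] by auto
  then show "ennreal (\<phi> n \<bar>f (snd (Is ! n)) - f (fst (Is ! n))\<bar>) =
      ennreal (\<phi> n \<bar>g (snd (Is ! n)) - g (fst (Is ! n))\<bar>)"
    using assms by simp
qed

lemma schramm_sequence_young: "schramm_sequence \<phi> \<Longrightarrow> young_function (\<phi> n)"
  unfolding schramm_sequence_def by blast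

lemma schramm_var_contract:
  assumes S: "schramm_sequence \<phi>" and "\<And>s t. \<bar>f s - f t\<bar> \<le> \<bar>g s - g t\<bar>"
  shows "schramm_var \<phi> f \<le> schramm_var \<phi> g"
  unfolding schramm_var_def
  by (intro SUP_mono' sum_mono ennreal_leI young_mono[OF schramm_sequence_young[OF S]])
     (use assms in auto)

lemma PhiBV_levels_upward:
  assumes S: "schramm_sequence \<phi>" and l: "l \<in> PhiBV_levels \<phi> f" and "l \<le> m"
  shows "m \<in> PhiBV_levels \<phi> f"
proof -
  have lm: "0 < l" "0 < m" using assms unfolding PhiBV_levels_def by auto
  have "schramm_var \<phi> (\<lambda>t. inverse m * f t) \<le> schramm_var \<phi> (\<lambda>t. inverse l * f t)"
    using lm \<open>l \<le> m\<close>
    by (intro schramm_var_contract[OF S])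
       (auto simp: right_diff_distrib[symmetric] abs_mult intro!: mult_right_mono)
  also have "\<dots> \<le> 1" using l unfolding PhiBV_levels_def by auto
  finally show ?thesis using lm unfolding PhiBV_levels_def by auto
qed

lemma PhiBV_cballI_level:
  assumes "schramm_sequence \<phi>" "\<bar>f 0\<bar> \<le> c" "c \<in> PhiBV_levels \<phi> f"
  shows "f \<in> PhiBV_cball \<phi> c"
  using assms PhiBV_levels_upward[of \<phi> c f] unfolding PhiBV_cball_def by auto

lemma PhiBV_cball_mono: "f \<in> PhiBV_cball \<phi> c \<Longrightarrow> c \<le> d \<Longrightarrow> f \<in> PhiBV_cball \<phi> d"
  unfolding PhiBV_cball_def by auto

lemma PhiBV_cball_cong:
  assumes "f \<in> PhiBV_cball \<phi> c" "\<And>t. t \<in> {0..1} \<Longrightarrow> g t = f t"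
  shows "g \<in> PhiBV_cball \<phi> c"
proof -
  have "PhiBV_levels \<phi> g = PhiBV_levels \<phi> f"
    unfolding PhiBV_levels_def using assms(2)
    by (intro Collect_cong conj_cong refl arg_cong[where f = "\<lambda>v. v \<le> 1"] schramm_var_cong) simp
  then show ?thesis using assms unfolding PhiBV_cball_def by simp
qed

lemma PhiBV_cball_add:
  assumes S: "schramm_sequence \<phi>" and f: "f \<in> PhiBV_cball \<phi> c" and g: "g \<in> PhiBV_cball \<phi> d"
  shows "(\<lambda>t. f t + g t) \<in> PhiBV_cball \<phi> (c + d)"
proof -
  have "l \<in> PhiBV_levels \<phi> (\<lambda>t. f t + g t)" if "l > c + d" for l
  proof -
    \<comment> \<open>The excess of \<open>l\<close> over \<open>c + d\<close> is shared equally, so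
      each summand is given a level strictly above its own radius.\<close>
    have "c + (l - c - d) / 2 \<in> PhiBV_levels \<phi> f" "d + (l - c - d) / 2 \<in> PhiBV_levels \<phi> g"
      using f g that unfolding PhiBV_cball_def by auto
    from PhiBV_levels_add[OF S this] show ?thesis by (simp add: field_simps)
  qed
  moreover have "\<bar>f 0 + g 0\<bar> \<le> c + d" using f g unfolding PhiBV_cball_def by auto
  ultimately show ?thesis unfolding PhiBV_cball_def by auto
qed

lemma PhiBV_cball_scale:
  assumes S: "schramm_sequence \<phi>" and f: "f \<in> PhiBV_cball \<phi> c" and a: "\<bar>a\<bar> * c \<le> d"
  shows "(\<lambda>t. a * f t) \<in> PhiBV_cball \<phi> d"
proof -
  have d: "0 \<le> d" using a PhiBV_cball_nonneg[OF f] by (meson abs_ge_zero mult_nonneg_nonneg order_trans)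
  have "l \<in> PhiBV_levels \<phi> (\<lambda>t. a * f t)" if "l > d" for l
  proof (cases "a = 0")
    case True
    then show ?thesis using d that unfolding PhiBV_levels_def by (simp add: schramm_var_const[OF S])
  next
    case False
    have "l / \<bar>a\<bar> > c" using a that False by (simp add: field_simps)
    then have lev: "l / \<bar>a\<bar> \<in> PhiBV_levels \<phi> f" using f unfolding PhiBV_cball_def by auto
    have "schramm_var \<phi> (\<lambda>t. inverse l * (a * f t)) = schramm_var \<phi> (\<lambda>t. inverse (l / \<bar>a\<bar>) * f t)"
    proof (cases "a > 0")
      case True
      then show ?thesis by (simp add: divide_inverse mult_ac)
    next
      case neg: False
      then show ?thesis using schramm_var_minus[of \<phi> "\<lambda>t. inverse l * (a * f t)"]
        by (simp add: divide_inverse mult_ac)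
    qed
    then show ?thesis using lev that d unfolding PhiBV_levels_def by auto
  qed
  moreover have "\<bar>a * f 0\<bar> \<le> d"
    using f a mult_left_mono[of "\<bar>f 0\<bar>" c "\<bar>a\<bar>"] unfolding PhiBV_cball_def abs_mult by auto
  ultimately show ?thesis unfolding PhiBV_cball_def by auto
qed

lemma PhiBV_cball_diff:
  assumes S: "schramm_sequence \<phi>" and f: "f \<in> PhiBV_cball \<phi> c" and g: "g \<in> PhiBV_cball \<phi> d"
  shows "(\<lambda>t. f t - g t) \<in> PhiBV_cball \<phi> (c + d)"
  using PhiBV_cball_add[OF S f PhiBV_cball_scale[OF S g, of "-1" d]] by simp

lemma PhiBV_cball_sum:
  assumes S: "schramm_sequence \<phi>" and "finite I" and "\<And>i. i \<in> I \<Longrightarrow> f i \<in> PhiBV_cball \<phi> (c i)"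
  shows "(\<lambda>t. \<Sum>i\<in>I. f i t) \<in> PhiBV_cball \<phi> (\<Sum>i\<in>I. c i)"
  using assms(2,3)
proof (induction I rule: finite_induct)
  case empty
  show ?case using schramm_var_const[OF S, of 0] by (simp add: PhiBV_cball_def PhiBV_levels_def)
next
  case (insert i I)
  then show ?case using PhiBV_cball_add[OF S, of "f i" "c i" "\<lambda>t. \<Sum>i\<in>I. f i t" "\<Sum>i\<in>I. c i"] by simp
qed

text \<open>Lower semicontinuity. Increments of \<open>f\<close>, divided by a level \<open>l > c\<close>, are eventually
  at most those of \<open>h n\<close> divided by a level strictly between \<open>c\<close> and \<open>l\<close>, so monotonicity of the
  Young functions suffices and their continuity is not needed.\<close>

lemma PhiBV_cball_lim:
  assumes S: "schramm_sequence \<phi>" and h: "\<forall>\<^sub>F n in sequentially. h n \<in> PhiBV_cball \<phi> c"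
    and lim: "\<And>t. t \<in> {0..1} \<Longrightarrow> (\<lambda>n. h n t) \<longlonglongrightarrow> f t"
  shows "f \<in> PhiBV_cball \<phi> c"
proof -
  have "(\<lambda>n. \<bar>h n 0\<bar>) \<longlonglongrightarrow> \<bar>f 0\<bar>" using lim[of 0] by (auto intro: tendsto_rabs)
  moreover have "\<forall>\<^sub>F n in sequentially. \<bar>h n 0\<bar> \<le> c"
    using h by eventually_elim (simp add: PhiBV_cball_def)
  ultimately have f0: "\<bar>f 0\<bar> \<le> c" by (rule tendsto_upperbound) simp
  have "l \<in> PhiBV_levels \<phi> f" if l: "l > c" for l
  proof -
    define m where "m = (c + l) / 2"
    have m: "0 < m" "m < l" "c < m" using f0 l by (auto simp: m_def)
    have "(\<Sum>n<length Is. ennreal (\<phi> n \<bar>inverse l * f (snd (Is ! n)) - inverse l * f (fst (Is ! n))\<bar>)) \<le> 1"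
      if Is: "Is \<in> interval_collections" for Is
    proof -
      let ?d = "\<lambda>g n. \<bar>g (snd (Is ! n)) - g (fst (Is ! n))\<bar> :: real"
      \<comment> \<open>A zero increment of \<open>f\<close> makes the left side zero. For a nonzero
        one the inequality between the factors \<open>inverse l\<close> and \<open>inverse m\<close>
        is strict and passes from the limit to the sequence.\<close>
      have ev: "\<forall>\<^sub>F j in sequentially. inverse l * ?d f n \<le> inverse m * ?d (h j) n" if n: "n < length Is" for n
      proof (cases "?d f n = 0")
        case True
        then show ?thesis using m by simp
      next
        case False
        have "fst (Is ! n) \<in> {0..1}" "snd (Is ! n) \<in> {0..1}"
          using interval_collections_endpoints[OF Is n] by auto
        then have "(\<lambda>j. inverse m * ?d (h j) n) \<longlonglongrightarrow> inverse m * ?d f n"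
          by (intro tendsto_intros lim)
        moreover have "inverse l * ?d f n < inverse m * ?d f n"
          using m False by (intro mult_strict_right_mono) auto
        ultimately have "\<forall>\<^sub>F j in sequentially. inverse l * ?d f n < inverse m * ?d (h j) n"
          by (rule order_tendstoD)
        then show ?thesis by eventually_elim simp
      qed
      have "\<forall>\<^sub>F j in sequentially. \<forall>n\<in>{..<length Is}. inverse l * ?d f n \<le> inverse m * ?d (h j) n"
        by (rule eventually_ball_finite) (use ev in auto)
      with h have "\<forall>\<^sub>F j in sequentially. h j \<in> PhiBV_cball \<phi> c \<and>
          (\<forall>n\<in>{..<length Is}. inverse l * ?d f n \<le> inverse m * ?d (h j) n)"
        by eventually_elim simp
      then obtain j where j: "h j \<in> PhiBV_cball \<phi> c"
        and le: "\<And>n. n < length Is \<Longrightarrow> inverse l * ?d f n \<le> inverse m * ?d (h j) n"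
        using eventually_happens'[OF sequentially_bot] by blast
      have "(\<Sum>n<length Is. ennreal (\<phi> n \<bar>inverse l * f (snd (Is ! n)) - inverse l * f (fst (Is ! n))\<bar>))
        \<le> (\<Sum>n<length Is. ennreal (\<phi> n \<bar>inverse m * h j (snd (Is ! n)) - inverse m * h j (fst (Is ! n))\<bar>))"
        using le m
        by (intro sum_mono ennreal_leI young_mono[OF schramm_sequence_young[OF S]])
           (simp_all add: right_diff_distrib[symmetric] abs_mult)
      also have "\<dots> \<le> schramm_var \<phi> (\<lambda>t. inverse m * h j t)"
        unfolding schramm_var_def by (rule SUP_upper[OF Is])
      also have "\<dots> \<le> 1" using j m unfolding PhiBV_cball_def PhiBV_levels_def by auto
      finally show ?thesis .
    qed
    then show ?thesis using m unfolding PhiBV_levels_def schramm_var_def by (auto intro: SUP_least)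
  qed
  with f0 show ?thesis unfolding PhiBV_cball_def by auto
qed

text \<open>Norm convergence hence forces pointwise convergence. The collection consisting of [0,t]
  alone involves only \<open>\<phi> 0\<close>, which by convexity exceeds 1 at some
  \<open>T\<close>; an increment divided by a level therefore cannot exceed
  \<open>T\<close>.\<close>

lemma PhiBV_cball_pointwise:
  assumes S: "schramm_sequence \<phi>"
  obtains C where "C > 0" "\<And>f c t. f \<in> PhiBV_cball \<phi> c \<Longrightarrow> t \<in> {0..1} \<Longrightarrow> \<bar>f t\<bar> \<le> C * c"
proof -
  have Y: "young_function (\<phi> 0)" by (rule schramm_sequence_young[OF S])
  have p: "\<phi> 0 1 > 0" using Y unfolding young_function_def by (metis less_eq_real_def zero_less_one zero_neq_one)
  \<comment> \<open>The quotient ensures \<open>T * \<phi> 0 1 > 1\<close>, and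
    \<open>T \<ge> 1\<close> makes \<open>1 / T\<close> a convex weight, so that convexity between 0
    and \<open>T\<close> can be applied at the point 1.\<close>
  define T where "T = max 1 (2 / \<phi> 0 1)"
  have T: "T \<ge> 1" "T * \<phi> 0 1 > 1"
    using p by (auto simp: T_def max_def field_simps)
  have "1 < \<phi> 0 T"
  proof -
    have "\<phi> 0 \<bar>(1 / T) * T + (1 - 1 / T) * 0\<bar> \<le> 1 / T * \<phi> 0 \<bar>T\<bar> + (1 - 1 / T) * \<phi> 0 \<bar>0\<bar>"
      by (rule young_comb[OF Y]) (use T in auto)
    moreover have "\<phi> 0 0 = 0" using Y by (simp add: young_function_def)
    ultimately have "T * \<phi> 0 1 \<le> \<phi> 0 T" using T by (simp add: field_simps)
    then show ?thesis using T by simp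
  qed
  have "\<bar>f t\<bar> \<le> (1 + T) * c" if f: "f \<in> PhiBV_cball \<phi> c" and t: "t \<in> {0..1}" for f c t
  proof -
    have "\<bar>f t - f 0\<bar> \<le> l * T" if l: "l > c" for l
    proof (rule ccontr)
      assume "\<not> \<bar>f t - f 0\<bar> \<le> l * T"
      moreover have l0: "l > 0" using l PhiBV_cball_nonneg[OF f] by simp
      ultimately have "T \<le> \<bar>inverse l * f t - inverse l * f 0\<bar>"
        by (simp add: right_diff_distrib[symmetric] abs_mult field_simps)
      then have "\<phi> 0 T \<le> \<phi> 0 \<bar>inverse l * f t - inverse l * f 0\<bar>"
        using T by (intro young_mono[OF Y]) auto
      moreover have "[(0, t)] \<in> interval_collections" using t unfolding interval_collections_def by auto
      then have "ennreal (\<phi> 0 \<bar>inverse l * f t - inverse l * f 0\<bar>) \<le> schramm_var \<phi> (\<lambda>t. inverse l * f t)"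
        unfolding schramm_var_def by (rule SUP_upper2) simp
      then have "ennreal (\<phi> 0 \<bar>inverse l * f t - inverse l * f 0\<bar>) \<le> 1"
        using f l unfolding PhiBV_cball_def PhiBV_levels_def by (blast intro: order_trans)
      ultimately show False using \<open>1 < \<phi> 0 T\<close> by simp
    qed
    then have "\<bar>f t - f 0\<bar> / T \<le> l" if "l > c" for l
      using that T by (simp add: pos_divide_le_eq)
    then have "\<bar>f t - f 0\<bar> / T \<le> c" by (rule dense_ge)
    then have "\<bar>f t - f 0\<bar> \<le> T * c" using T by (simp add: field_simps)
    moreover have "\<bar>f 0\<bar> \<le> c" using f unfolding PhiBV_cball_def by simp
    ultimately show ?thesis by (simp add: algebra_simps)
  qed
  then show thesis using T by (intro that[of "1 + T"]) auto
qed

section \<open>Comparison of the balls with the metric, and completeness\<close>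

lemma PhiBV_iff_cball:
  assumes S: "schramm_sequence \<phi>"
  shows "f \<in> PhiBV \<phi> \<longleftrightarrow> f \<in> extensional {0..1} \<and> (\<exists>c. f \<in> PhiBV_cball \<phi> c)"
proof (intro iffI conjI)
  assume f: "f \<in> PhiBV \<phi>"
  then show "f \<in> extensional {0..1}" unfolding PhiBV_def by simp
  obtain l where "l \<in> PhiBV_levels \<phi> f" using PhiBV_levels_nonempty[OF S f] by auto
  then have "max l \<bar>f 0\<bar> \<in> PhiBV_levels \<phi> f" by (rule PhiBV_levels_upward[OF S]) simp
  then show "\<exists>c. f \<in> PhiBV_cball \<phi> c" using PhiBV_cballI_level[OF S] by (meson max.cobounded2)
next
  assume f: "f \<in> extensional {0..1} \<and> (\<exists>c. f \<in> PhiBV_cball \<phi> c)"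
  then obtain c where c: "f \<in> PhiBV_cball \<phi> c" by auto
  \<comment> \<open>The radius \<open>c\<close> may be 0 or fail to be a level, whereas every number
    strictly above it is one.\<close>
  then have "c + 1 \<in> PhiBV_levels \<phi> f" unfolding PhiBV_cball_def by auto
  then have "inverse (c + 1) > 0" "schramm_var \<phi> (\<lambda>t. inverse (c + 1) * f t) < \<infinity>"
    unfolding PhiBV_levels_def by (auto elim!: le_less_trans)
  then show "f \<in> PhiBV \<phi>" using f unfolding PhiBV_def by blast
qed

text \<open>The norm adds the value at 0 and the seminorm, while the ball bounds each of them by
  \<open>c\<close>; hence the factor 2.\<close>

lemma PhiBV_dist_le:
  assumes "f \<in> PhiBV \<phi>" "g \<in> PhiBV \<phi>" and c: "(\<lambda>t. f t - g t) \<in> PhiBV_cball \<phi> c"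
  shows "PhiBV_dist \<phi> f g \<le> 2 * c"
proof -
  have "Inf (PhiBV_levels \<phi> (\<lambda>t. f t - g t)) \<le> l" if "l > c" for l
    using c that by (intro cInf_lower bdd_belowI[of _ 0]) (auto simp: PhiBV_cball_def PhiBV_levels_def)
  then have "Inf (PhiBV_levels \<phi> (\<lambda>t. f t - g t)) \<le> c" by (rule dense_ge)
  moreover have "\<bar>f 0 - g 0\<bar> \<le> c" using c unfolding PhiBV_cball_def by simp
  ultimately show ?thesis
    using assms unfolding PhiBV_dist_def PhiBV_norm_def PhiBV_seminorm_def PhiBV_levels_def by simp
qed

text \<open>A strict bound on the infimum yields an actual level below \<open>c\<close>, and the set
  of levels is closed upwards.\<close>

lemma PhiBV_dist_less_imp_cball:
  assumes S: "schramm_sequence \<phi>" and f: "f \<in> PhiBV \<phi>" and g: "g \<in> PhiBV \<phi>"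
    and d: "PhiBV_dist \<phi> f g < c"
  shows "(\<lambda>t. f t - g t) \<in> PhiBV_cball \<phi> c"
proof -
  obtain a b where "f \<in> PhiBV_cball \<phi> a" "g \<in> PhiBV_cball \<phi> b"
    using f g PhiBV_iff_cball[OF S] by blast
  from PhiBV_cball_diff[OF S this] have ne: "PhiBV_levels \<phi> (\<lambda>t. f t - g t) \<noteq> {}"
    unfolding PhiBV_cball_def by (metis (mono_tags, lifting) empty_iff gt_ex mem_Collect_eq)
  have "\<bar>f 0 - g 0\<bar> + Inf (PhiBV_levels \<phi> (\<lambda>t. f t - g t)) < c"
    using f g d unfolding PhiBV_dist_def PhiBV_norm_def PhiBV_seminorm_def PhiBV_levels_def by simp
  with Inf_PhiBV_levels_ge_0[OF ne] have 0: "\<bar>f 0 - g 0\<bar> \<le> c"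
    and "Inf (PhiBV_levels \<phi> (\<lambda>t. f t - g t)) < c" by auto
  then obtain l where "l \<in> PhiBV_levels \<phi> (\<lambda>t. f t - g t)" "l < c"
    using cInf_lessD[OF ne] by blast
  then have "c \<in> PhiBV_levels \<phi> (\<lambda>t. f t - g t)" using PhiBV_levels_upward[OF S] by auto
  with 0 show ?thesis by (intro PhiBV_cballI_level[OF S])
qed

text \<open>A Cauchy sequence converges pointwise because the balls control values; closedness of
  the balls under pointwise limits upgrades this to convergence in norm.\<close>

lemma mcomplete_PhiBV:
  assumes S: "schramm_sequence \<phi>"
  shows "Metric_space.mcomplete (PhiBV \<phi>) (PhiBV_dist \<phi>)"
proof -
  interpret Metric_space "PhiBV \<phi>" "PhiBV_dist \<phi>" by (rule Metric_space_PhiBV[OF S])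
  obtain C where C: "C > 0" "\<And>f c t. f \<in> PhiBV_cball \<phi> c \<Longrightarrow> t \<in> {0..1} \<Longrightarrow> \<bar>f t\<bar> \<le> C * c"
    using PhiBV_cball_pointwise[OF S] by blast
  show ?thesis
    unfolding mcomplete_def
  proof (intro allI impI)
    fix \<sigma> assume \<sigma>: "MCauchy \<sigma>"
    then have mem: "\<sigma> n \<in> PhiBV \<phi>" for n unfolding MCauchy_def by auto
    have cau: "\<exists>N. \<forall>m n. N \<le> m \<longrightarrow> N \<le> n \<longrightarrow> (\<lambda>t. \<sigma> m t - \<sigma> n t) \<in> PhiBV_cball \<phi> e" if "e > 0" for e
    proof -
      obtain N where "\<And>m n. N \<le> m \<Longrightarrow> N \<le> n \<Longrightarrow> PhiBV_dist \<phi> (\<sigma> m) (\<sigma> n) < e"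
        using \<sigma> \<open>e > 0\<close> unfolding MCauchy_def by blast
      then show ?thesis using PhiBV_dist_less_imp_cball[OF S mem mem] by blast
    qed
    have "Cauchy (\<lambda>n. \<sigma> n t)" if t: "t \<in> {0..1}" for t
    proof (rule metric_CauchyI)
      fix e :: real assume "e > 0"
      then have "e / (2 * C) > 0" using C by simp
      then obtain N where N: "\<And>m n. N \<le> m \<Longrightarrow> N \<le> n \<Longrightarrow> (\<lambda>t. \<sigma> m t - \<sigma> n t) \<in> PhiBV_cball \<phi> (e / (2 * C))"
        using cau by blast
      have "\<bar>\<sigma> m t - \<sigma> n t\<bar> < e" if "N \<le> m" "N \<le> n" for m n
        using C(2)[OF N[OF that] t] C(1) \<open>e > 0\<close> by simp
      then show "\<exists>N. \<forall>m\<ge>N. \<forall>n\<ge>N. dist (\<sigma> m t) (\<sigma> n t) < e" unfolding dist_real_def by blast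
    qed
    then have "\<exists>y. (\<lambda>n. \<sigma> n t) \<longlonglongrightarrow> y" if "t \<in> {0..1}" for t
      using that Cauchy_convergent_iff convergent_def by blast
    then obtain g where g: "\<And>t. t \<in> {0..1} \<Longrightarrow> (\<lambda>n. \<sigma> n t) \<longlonglongrightarrow> g t" by metis
    define y where "y = restrict g {0..1}"
    have near: "\<exists>N. \<forall>n\<ge>N. (\<lambda>t. \<sigma> n t - y t) \<in> PhiBV_cball \<phi> e" if e: "e > 0" for e
    proof -
      obtain N where N: "\<And>m n. N \<le> m \<Longrightarrow> N \<le> n \<Longrightarrow> (\<lambda>t. \<sigma> m t - \<sigma> n t) \<in> PhiBV_cball \<phi> e"
        using cau[OF e] by blast
      \<comment> \<open>With \<open>n\<close> fixed, the Cauchy estimate passes to the limit in the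
        other index.\<close>
      have "(\<lambda>t. \<sigma> n t - y t) \<in> PhiBV_cball \<phi> e" if "n \<ge> N" for n
      proof (rule PhiBV_cball_lim[OF S])
        show "\<forall>\<^sub>F m in sequentially. (\<lambda>t. \<sigma> n t - \<sigma> m t) \<in> PhiBV_cball \<phi> e"
          using N that by (auto simp: eventually_sequentially)
        show "(\<lambda>m. \<sigma> n t - \<sigma> m t) \<longlonglongrightarrow> \<sigma> n t - y t" if "t \<in> {0..1}" for t
          using g[OF that] that by (auto simp: y_def intro: tendsto_diff)
      qed
      then show ?thesis by blast
    qed
    obtain n where n: "(\<lambda>t. \<sigma> n t - y t) \<in> PhiBV_cball \<phi> 1" using near[of 1] by auto
    obtain c where "\<sigma> n \<in> PhiBV_cball \<phi> c" using mem PhiBV_iff_cball[OF S] by blast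
    from PhiBV_cball_diff[OF S this n] have "y \<in> PhiBV_cball \<phi> (c + 1)" by simp
    then have y: "y \<in> PhiBV \<phi>" unfolding PhiBV_iff_cball[OF S] by (auto simp: y_def)
    have "\<exists>N. \<forall>n\<ge>N. \<sigma> n \<in> PhiBV \<phi> \<and> PhiBV_dist \<phi> (\<sigma> n) y < e" if "e > 0" for e
    proof -
      obtain N where N: "\<And>n. n \<ge> N \<Longrightarrow> (\<lambda>t. \<sigma> n t - y t) \<in> PhiBV_cball \<phi> (e / 3)"
        using near[of "e / 3"] \<open>e > 0\<close> by auto
      have "PhiBV_dist \<phi> (\<sigma> n) y < e" if "n \<ge> N" for n
        using PhiBV_dist_le[OF mem y N[OF that]] \<open>e > 0\<close> by simp
      then show ?thesis using mem by blast
    qed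
    then show "\<exists>x. limitin mtopology \<sigma> x sequentially"
      using y unfolding limit_metric_sequentially by blast
  qed
qed

subsection \<open>Integrals over short intervals\<close>

lemma null_sets_lebesgue_finite: "finite (N::real set) \<Longrightarrow> N \<in> null_sets lebesgue"
  using negligible_finite negligible_iff_null_sets by blast

text \<open>The endpoints are the infimum and the supremum of \<open>S\<close>; which of them belong
  to \<open>S\<close> is left open, since they form a null set. The empty set is enclosed by the
  degenerate interval at 0.\<close>

lemma is_interval_bounds:
  fixes S :: "real set"
  assumes S: "S \<subseteq> {0..1}" "is_interval S"
    and d: "0 \<le> d" "\<forall>x\<in>S. \<forall>y\<in>S. y \<le> x + d"
  obtains a b where "0 \<le> a" "a \<le> b" "b \<le> 1" "b - a \<le> d" "{a<..<b} \<subseteq> S" "S \<subseteq> {a..b}"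
proof (cases "S = {}")
  case True
  then show ?thesis using that[of 0 0] d by auto
next
  case False
  have bd: "bdd_below S" "bdd_above S" using bdd_below_mono[OF _ S(1)] bdd_above_mono[OF _ S(1)] by auto
  have sub: "S \<subseteq> {Inf S..Sup S}" using bd by (auto intro: cInf_lower cSup_upper)
  show ?thesis
  proof (rule that[of "Inf S" "Sup S"])
    show "0 \<le> Inf S" by (rule cInf_greatest[OF False]) (use S in auto)
    show "Sup S \<le> 1" by (rule cSup_least[OF False]) (use S in auto)
    show "Inf S \<le> Sup S" using cInf_le_cSup[OF False] bd by blast
    show "S \<subseteq> {Inf S..Sup S}" by (rule sub)
    have "Sup S \<le> x + d" if "x \<in> S" for x
      by (rule cSup_least[OF False]) (use d that in auto)
    then have "Sup S - d \<le> Inf S"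
      by (intro cInf_greatest[OF False]) (auto simp: algebra_simps)
    then show "Sup S - Inf S \<le> d" by simp
    show "{Inf S<..<Sup S} \<subseteq> S"
    proof
      fix y assume "y \<in> {Inf S<..<Sup S}"
      then obtain x z where "x \<in> S" "x < y" "z \<in> S" "y < z"
        using cInf_lessD[OF False, of y] less_cSupD[OF False, of y] by auto
      then show "y \<in> S" using S(2) unfolding is_interval_1 by (meson less_imp_le)
    qed
  qed
qed

lemma interval_lebesgue:
  fixes S :: "real set"
  assumes "{a<..<b} \<subseteq> S" "S \<subseteq> {a..b}"
  shows "S \<in> sets lebesgue"
proof -
  have "S = {a<..<b} \<union> (S \<inter> {a, b})" using assms by force
  moreover have "S \<inter> {a, b} \<in> sets lebesgue"
    using null_sets_lebesgue_finite[of "S \<inter> {a, b}"] by auto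
  moreover have "{a<..<b} \<in> sets lebesgue" by simp
  ultimately show ?thesis by (metis sets.Un)
qed

lemma interval_set_integral:
  fixes f :: "real \<Rightarrow> real"
  assumes S: "{a<..<b} \<subseteq> S" "S \<subseteq> {a..b}" and f: "set_integrable lebesgue {a..b} f"
  shows "(LINT s:S|lebesgue. f s) = (LINT s:{a..b}|lebesgue. f s)"
proof (rule set_integral_cong_set)
  show ab: "set_borel_measurable lebesgue {a..b} f"
    using f unfolding set_integrable_def set_borel_measurable_def by blast
  show "set_borel_measurable lebesgue S f"
    by (rule set_borel_measurable_subset[OF ab interval_lebesgue[OF S] S(2)])
  have "AE x in lebesgue. x \<notin> {a, b}"
    by (rule AE_not_in[OF null_sets_lebesgue_finite]) simp
  then show "AE x in lebesgue. (x \<in> {a..b}) = (x \<in> S)"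
    by eventually_elim (use S in force)
qed

lemma set_integrable_unit_subinterval:
  fixes f :: "real \<Rightarrow> real"
  assumes "set_integrable lebesgue {0..1} f" "0 \<le> a" "b \<le> 1"
  shows "set_integrable lebesgue {a..b} f"
  by (rule set_integrable_subset[OF assms(1)]) (use assms in auto)

text \<open>Absolute continuity of the integral, obtained from uniform continuity of the indefinite
  integral on the compact interval [0,1].\<close>

lemma set_integral_short_interval:
  fixes f :: "real \<Rightarrow> real"
  assumes f: "set_integrable lebesgue {0..1} f" and e: "e > 0"
  obtains d where "d > 0"
    "\<And>a b. 0 \<le> a \<Longrightarrow> a \<le> b \<Longrightarrow> b \<le> 1 \<Longrightarrow> b - a \<le> d \<Longrightarrow> \<bar>LINT s:{a..b}|lebesgue. f s\<bar> \<le> e"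
proof -
  have int: "f integrable_on {0..1}" by (rule set_lebesgue_integral_eq_integral(1)[OF f])
  have "uniformly_continuous_on {0..1} (\<lambda>x. integral {0..x} f)"
    by (intro compact_uniformly_continuous indefinite_integral_continuous_1 int) simp
  then obtain d where d: "d > 0" "\<And>x y. x \<in> {0..1} \<Longrightarrow> y \<in> {0..1} \<Longrightarrow> dist y x < d \<Longrightarrow>
      dist (integral {0..y} f) (integral {0..x} f) < e"
    using e unfolding uniformly_continuous_on_def by metis
  show thesis
  proof (rule that[of "d / 2"])
    fix a b :: real assume ab: "0 \<le> a" "a \<le> b" "b \<le> 1" "b - a \<le> d / 2"
    have "(LINT s:{a..b}|lebesgue. f s) = integral {a..b} f"
      by (rule set_lebesgue_integral_eq_integral(2)[OF set_integrable_unit_subinterval[OF f]]) (use ab in auto)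
    also have "\<dots> = integral {0..b} f - integral {0..a} f"
      using Henstock_Kurzweil_Integration.integral_combine[OF ab(1,2), of f]
        integrable_on_subinterval[OF int, of 0 b] ab by auto
    finally show "\<bar>LINT s:{a..b}|lebesgue. f s\<bar> \<le> e"
      using d(2)[of a b] d(1) ab by (auto simp: dist_real_def)
  qed (use d in simp)
qed

section \<open>Integrals against monotone functions\<close>

lemma set_integrable_mult_mono_on:
  fixes f g :: "real \<Rightarrow> real"
  assumes f: "set_integrable lebesgue {0..1} f" and g: "mono_on {0..1} g"
  shows "set_integrable lebesgue {0..1} (\<lambda>s. f s * g s)"
proof (rule set_integrable_bound)
  show "set_integrable lebesgue {0..1} (\<lambda>s. (\<bar>g 0\<bar> + \<bar>g 1\<bar> + 1) * f s)"
    using f by (intro set_integrable_mult_right)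
  have "(\<lambda>s. indicator {0..1} s *\<^sub>R g s) \<in> borel_measurable borel"
    using borel_measurable_mono_on_fnc[OF g] by (subst (asm) borel_measurable_restrict_space_iff) auto
  then have "(\<lambda>s. indicator {0..1} s *\<^sub>R g s) \<in> borel_measurable lebesgue"
    by (simp add: measurable_completion)
  moreover have "(\<lambda>s. indicator {0..1} s *\<^sub>R f s) \<in> borel_measurable lebesgue"
    using f unfolding set_integrable_def by blast
  \<comment> \<open>Each factor is measurable after truncation to [0,1]; the product carries the
    square of the indicator, which is the indicator again.\<close>
  ultimately have "(\<lambda>s. (indicator {0..1} s *\<^sub>R f s) * (indicator {0..1} s *\<^sub>R g s)) \<in> borel_measurable lebesgue"
    by (rule borel_measurable_times[rotated])
  also have "(\<lambda>s. (indicator {0..1} s *\<^sub>R f s) * (indicator {0..1} s *\<^sub>R g s)) =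
      (\<lambda>s. indicator {0..1} s *\<^sub>R (f s * g s))"
    by (auto simp: indicator_def)
  finally show "set_borel_measurable lebesgue {0..1} (\<lambda>s. f s * g s)"
    unfolding set_borel_measurable_def .
  have "\<bar>f s * g s\<bar> \<le> \<bar>(\<bar>g 0\<bar> + \<bar>g 1\<bar> + 1) * f s\<bar>" if "s \<in> {0..1}" for s
  proof -
    have "g 0 \<le> g s" "g s \<le> g 1" using that g by (auto intro: mono_onD)
    then have "\<bar>g s\<bar> \<le> \<bar>g 0\<bar> + \<bar>g 1\<bar> + 1" by linarith
    then show ?thesis by (simp add: abs_mult mult.commute mult_left_mono)
  qed
  then show "AE s in lebesgue. s \<in> {0..1} \<longrightarrow> norm (f s * g s) \<le> norm ((\<bar>g 0\<bar> + \<bar>g 1\<bar> + 1) * f s)"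
    by simp
qed

lemma set_integral_mult_bound:
  fixes f w :: "real \<Rightarrow> real"
  assumes f: "set_integrable lebesgue A f" and fw: "set_integrable lebesgue A (\<lambda>s. f s * w s)"
    and w: "\<And>s. s \<in> A \<Longrightarrow> \<bar>w s\<bar> \<le> c"
  shows "\<bar>LINT s:A|lebesgue. f s * w s\<bar> \<le> c * (LINT s:A|lebesgue. \<bar>f s\<bar>)"
proof -
  have "\<bar>LINT s:A|lebesgue. f s * w s\<bar> \<le> (LINT s:A|lebesgue. \<bar>f s * w s\<bar>)"
    using integral_norm_bound[of lebesgue "\<lambda>s. indicator A s *\<^sub>R (f s * w s)"]
    unfolding set_lebesgue_integral_def by (simp add: abs_mult)
  also have "\<dots> \<le> (LINT s:A|lebesgue. \<bar>f s\<bar> * c)"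
    using w f by (intro set_integral_mono set_integrable_abs[OF fw] set_integrable_mult_left set_integrable_abs)
       (auto simp: abs_mult mult_left_mono)
  finally show ?thesis by (simp add: mult.commute)
qed

text \<open>A discrete layer-cake formula: after division by \<open>M\<close>, the average of the
  indicators of the conditions \<open>j / M \<le> y\<close> is \<open>y\<close> rounded down to a
  multiple of \<open>1 / M\<close>.\<close>

lemma sum_of_bool_le_floor:
  fixes y :: real
  assumes "0 \<le> y" "y \<le> 1" and M: "M > 0"
  shows "(\<Sum>j=1..M. of_bool (real j / real M \<le> y)) = real_of_int \<lfloor>real M * y\<rfloor>"
proof -
  have *: "nat \<lfloor>real M * y\<rfloor> \<le> M"
  proof -
    have "real M * y \<le> real M" using assms mult_left_mono[of y 1 "real M"] by simp
    then show ?thesis by (simp add: nat_le_iff floor_le_iff)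
  qed
  have "real j / real M \<le> y \<longleftrightarrow> j \<le> nat \<lfloor>real M * y\<rfloor>" for j
    using assms by (simp add: pos_divide_le_eq le_nat_iff le_floor_iff mult.commute)
  then have "(\<Sum>j=1..M. of_bool (real j / real M \<le> y)) = (\<Sum>j=1..M. of_bool (j \<le> nat \<lfloor>real M * y\<rfloor>) :: real)"
    by simp
  also have "\<dots> = real (card {j\<in>{1..M}. j \<le> nat \<lfloor>real M * y\<rfloor>})"
    by (simp add: of_bool_def sum.If_cases Int_def)
  also have "{j\<in>{1..M}. j \<le> nat \<lfloor>real M * y\<rfloor>} = {1..nat \<lfloor>real M * y\<rfloor>}" using * by auto
  finally show ?thesis using assms by simp
qed

text \<open>Extends the hypothesis from closed intervals to all order-convex sets of diameter at
  most \<open>d\<close>, such as level sets of monotone functions. Adding endpoints leaves the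
  integral unchanged.\<close>

lemma interval_integral_cball:
  fixes k :: "real \<Rightarrow> real \<Rightarrow> real"
  assumes k': "\<forall>t\<in>{0..1}. set_integrable lebesgue {0..1} (k t)"
    and E: "\<forall>a b. 0 \<le> a \<and> a \<le> b \<and> b \<le> 1 \<and> b - a \<le> d \<longrightarrow>
      (\<lambda>t. LINT s:{a..b}|lebesgue. k t s) \<in> PhiBV_cball \<phi> e"
    and S: "S \<subseteq> {0..1}" "is_interval S"
    and d: "0 \<le> d" "\<forall>x\<in>S. \<forall>y\<in>S. y \<le> x + d"
  shows "(\<lambda>t. LINT s:S|lebesgue. k t s) \<in> PhiBV_cball \<phi> e" "S \<in> sets lebesgue"
proof -
  note k = k'[rule_format]
  obtain a b where ab: "0 \<le> a" "a \<le> b" "b \<le> 1" "b - a \<le> d" "{a<..<b} \<subseteq> S" "S \<subseteq> {a..b}"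
    using is_interval_bounds[OF S d] by blast
  show "S \<in> sets lebesgue" by (rule interval_lebesgue[OF ab(5,6)])
  show "(\<lambda>t. LINT s:S|lebesgue. k t s) \<in> PhiBV_cball \<phi> e"
    by (rule PhiBV_cball_cong[OF E[rule_format, OF conjI[OF ab(1) conjI[OF ab(2) conjI[OF ab(3,4)]]]]])
       (rule interval_set_integral[OF ab(5,6) set_integrable_unit_subinterval[OF k ab(1,3)]])
qed

lemma set_integral_unit_indicator:
  fixes f :: "real \<Rightarrow> real"
  assumes "S \<subseteq> {0..1}"
  shows "(LINT s:S|lebesgue. f s) = (LINT s:{0..1}|lebesgue. f s * indicator S s)"
  unfolding set_lebesgue_integral_def
  by (rule Bochner_Integration.integral_cong) (use assms in \<open>auto simp: indicator_def\<close>)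

lemma set_integrable_mult_indicator:
  fixes f :: "real \<Rightarrow> real"
  assumes "set_integrable lebesgue {0..1} f" "S \<in> sets lebesgue"
  shows "set_integrable lebesgue {0..1} (\<lambda>s. f s * indicator S s)"
  using integrable_mult_indicator[OF assms(2) assms(1)[unfolded set_integrable_def]]
  unfolding set_integrable_def by (simp add: mult_ac)

lemma set_integral_sum:
  fixes f :: "'i \<Rightarrow> 'a \<Rightarrow> real"
  assumes "\<And>i. i \<in> I \<Longrightarrow> set_integrable M A (f i)"
  shows "set_integrable M A (\<lambda>s. \<Sum>i\<in>I. f i s)"
    "(LINT s:A|M. (\<Sum>i\<in>I. f i s)) = (\<Sum>i\<in>I. LINT s:A|M. f i s)"
proof -
  have "integrable M (\<lambda>s. indicator A s *\<^sub>R f i s)" if "i \<in> I" for i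
    using assms[OF that] unfolding set_integrable_def .
  note * = Bochner_Integration.integrable_sum[OF this] Bochner_Integration.integral_sum[OF this]
  show "set_integrable M A (\<lambda>s. \<Sum>i\<in>I. f i s)"
    unfolding set_integrable_def scaleR_sum_right by (rule *(1))
  show "(LINT s:A|M. (\<Sum>i\<in>I. f i s)) = (\<Sum>i\<in>I. LINT s:A|M. f i s)"
    unfolding set_lebesgue_integral_def scaleR_sum_right by (rule *(2))
qed

text \<open>The superlevel sets of \<open>g\<close> and of \<open>g \<circ> \<nu>\<close> differ by an interval of diameter at most
  \<open>d\<close>, and \<open>g - g \<circ> \<nu>\<close> is a uniform limit of averages of the indicators of such differences.\<close>

lemma mono_on_integral_cball:
  fixes k :: "real \<Rightarrow> real \<Rightarrow> real"
  assumes \<phi>: "schramm_sequence \<phi>"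
    and k': "\<forall>t\<in>{0..1}. set_integrable lebesgue {0..1} (k t)"
    and E: "\<forall>a b. 0 \<le> a \<and> a \<le> b \<and> b \<le> 1 \<and> b - a \<le> d \<longrightarrow>
      (\<lambda>t. LINT s:{a..b}|lebesgue. k t s) \<in> PhiBV_cball \<phi> e"
    and d: "0 \<le> d"
    and g: "mono_on {0..1} g" "\<And>s. s \<in> {0..1} \<Longrightarrow> g s \<in> {0..1}"
    and \<nu>: "mono_on {0..1} \<nu>" "\<And>s. s \<in> {0..1} \<Longrightarrow> 0 \<le> \<nu> s \<and> \<nu> s \<le> s \<and> s \<le> \<nu> s + d"
  shows "(\<lambda>t. LINT s:{0..1}|lebesgue. k t s * (g s - g (\<nu> s))) \<in> PhiBV_cball \<phi> e"
proof -
  note k = k'[rule_format]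
  have \<nu>01: "\<nu> s \<in> {0..1}" if "s \<in> {0..1}" for s using \<nu>(2)[OF that] that by (auto elim: order_trans)
  have g\<nu>: "mono_on {0..1} (\<lambda>s. g (\<nu> s))"
    by (intro mono_onI mono_onD[OF g(1)] mono_onD[OF \<nu>(1)] \<nu>01)
  have le: "g (\<nu> s) \<le> g s" if "s \<in> {0..1}" for s
    using \<nu>(2)[OF that] \<nu>01[OF that] that by (intro mono_onD[OF g(1)]) auto
  \<comment> \<open>Since \<open>g (\<nu> s) \<le> g s\<close>, the indicator of
    \<open>A j n\<close> is the difference of the indicators of two superlevel sets at height
    \<open>j / (n + 1)\<close>.\<close>
  define A where "A j n = {s\<in>{0..1}. g (\<nu> s) < real j / Suc n \<and> real j / Suc n \<le> g s}" for j n :: nat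
  have A: "(\<lambda>t. LINT s:A j n|lebesgue. k t s) \<in> PhiBV_cball \<phi> e" "A j n \<in> sets lebesgue" for j n
  proof -
    have 1: "A j n \<subseteq> {0..1}" unfolding A_def by auto
    have 2: "is_interval (A j n)"
      unfolding is_interval_1
    proof clarify
      fix x z y assume that: "x \<in> A j n" "z \<in> A j n" "x \<le> y" "y \<le> z"
      have "g x \<le> g y" "g (\<nu> y) \<le> g (\<nu> z)"
        using that by (auto simp: A_def intro!: mono_onD[OF g(1)] mono_onD[OF g\<nu>])
      then show "y \<in> A j n" using that unfolding A_def by auto
    qed
    \<comment> \<open>If \<open>x \<le> \<nu> y\<close>, then \<open>g (\<nu> y)\<close> would
      already reach the height that \<open>g x\<close> reaches. So \<open>\<nu> y < x\<close>, and
      rounding moves \<open>y\<close> by at most \<open>d\<close>.\<close>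
    have 3: "\<forall>x\<in>A j n. \<forall>y\<in>A j n. y \<le> x + d"
    proof clarify
      fix x y assume xy: "x \<in> A j n" "y \<in> A j n"
      have "\<nu> y < x"
      proof (rule ccontr)
        assume "\<not> \<nu> y < x"
        then have "g x \<le> g (\<nu> y)"
          using xy \<nu>01[of y] by (intro mono_onD[OF g(1)]) (auto simp: A_def)
        then show False using xy unfolding A_def by auto
      qed
      then show "y \<le> x + d" using \<nu>(2)[of y] xy by (auto simp: A_def)
    qed
    show "(\<lambda>t. LINT s:A j n|lebesgue. k t s) \<in> PhiBV_cball \<phi> e" "A j n \<in> sets lebesgue"
      using interval_integral_cball[OF k' E 1 2 d 3] by auto
  qed
  define u where "u n s = (\<Sum>j=1..Suc n. (1 / Suc n) * indicator (A j n) s :: real)" for n s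
  define F where "F n t = (\<Sum>j=1..Suc n. (1 / Suc n) * (LINT s:A j n|lebesgue. k t s))" for n t
  \<comment> \<open>The weights \<open>1 / (n + 1)\<close> sum to 1, so averaging preserves the
    radius \<open>e\<close>.\<close>
  have F: "F n \<in> PhiBV_cball \<phi> e" for n
  proof -
    have "F n \<in> PhiBV_cball \<phi> (\<Sum>j=1..Suc n. (1 / Suc n) * e)"
      unfolding F_def by (intro PhiBV_cball_sum[OF \<phi>] PhiBV_cball_scale[OF \<phi> A(1)]) auto
    then show ?thesis by simp
  qed
  \<comment> \<open>After scaling by \<open>n + 1\<close>, both superlevel counts are floors. Each
    floor is off by less than 1, with the same sign, so their difference is off by at most
    1.\<close>
  have u: "\<bar>u n s - (g s - g (\<nu> s))\<bar> \<le> 1 / Suc n" if s: "s \<in> {0..1}" for n s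
  proof -
    have "real (Suc n) * u n s = (\<Sum>j=1..Suc n. of_bool (real j / Suc n \<le> g s) - of_bool (real j / Suc n \<le> g (\<nu> s)))"
      unfolding u_def sum_distrib_left
      by (intro sum.cong) (use s le[OF s] in \<open>auto simp: A_def indicator_def of_bool_def\<close>)
    also have "\<dots> = real_of_int \<lfloor>real (Suc n) * g s\<rfloor> - real_of_int \<lfloor>real (Suc n) * g (\<nu> s)\<rfloor>"
      unfolding sum_subtractf using g(2)[OF s] g(2)[OF \<nu>01[OF s]]
      by (subst (1 2) sum_of_bool_le_floor) auto
    finally have "\<bar>real (Suc n) * (u n s - (g s - g (\<nu> s)))\<bar> \<le> 1"
      unfolding right_diff_distrib by linarith
    then show ?thesis unfolding abs_mult by (simp add: field_simps)
  qed
  have lim: "(\<lambda>n. F n t) \<longlonglongrightarrow> (LINT s:{0..1}|lebesgue. k t s * (g s - g (\<nu> s)))"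
    if t: "t \<in> {0..1}" for t
  proof -
    have i1: "set_integrable lebesgue {0..1} (\<lambda>s. k t s * (g s - g (\<nu> s)))"
      unfolding right_diff_distrib
      by (intro set_integral_diff set_integrable_mult_mono_on k t g(1) g\<nu>)
    have i2: "set_integrable lebesgue {0..1} (\<lambda>s. (1 / Suc n) * (k t s * indicator (A j n) s))" for j n
      by (intro set_integrable_mult_right set_integrable_mult_indicator k t A(2))
    have ku: "k t s * u n s = (\<Sum>j=1..Suc n. (1 / Suc n) * (k t s * indicator (A j n) s))" for n s
      unfolding u_def sum_distrib_left by (intro sum.cong) auto
    have i3: "set_integrable lebesgue {0..1} (\<lambda>s. k t s * u n s)" for n
      unfolding ku by (intro set_integral_sum i2)
    have Fu: "F n t = (LINT s:{0..1}|lebesgue. k t s * u n s)" for n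
    proof -
      have "A j n \<subseteq> {0..1}" for j unfolding A_def by auto
      then have "(LINT s:A j n|lebesgue. k t s) = (LINT s:{0..1}|lebesgue. k t s * indicator (A j n) s)" for j
        by (rule set_integral_unit_indicator)
      then have "F n t = (\<Sum>j=1..Suc n. LINT s:{0..1}|lebesgue. (1 / Suc n) * (k t s * indicator (A j n) s))"
        unfolding F_def by (simp only: set_integral_mult_right)
      also have "\<dots> = (LINT s:{0..1}|lebesgue. k t s * u n s)"
        unfolding ku by (intro set_integral_sum(2)[symmetric] i2)
      finally show ?thesis .
    qed
    \<comment> \<open>The uniform error of \<open>u n\<close> is multiplied by the L1 norm of
      \<open>k t\<close>, which may depend on \<open>t\<close> because only pointwise convergence is
      sought.\<close>
    have bound: "\<bar>F n t - (LINT s:{0..1}|lebesgue. k t s * (g s - g (\<nu> s)))\<bar>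
        \<le> 1 / Suc n * (LINT s:{0..1}|lebesgue. \<bar>k t s\<bar>)" for n
    proof -
      have "F n t - (LINT s:{0..1}|lebesgue. k t s * (g s - g (\<nu> s))) =
          (LINT s:{0..1}|lebesgue. k t s * u n s - k t s * (g s - g (\<nu> s)))"
        unfolding Fu by (rule set_integral_diff(2)[OF i3 i1, symmetric])
      also have "\<dots> = (LINT s:{0..1}|lebesgue. k t s * (u n s - (g s - g (\<nu> s))))"
        by (simp only: right_diff_distrib)
      finally have "\<bar>F n t - (LINT s:{0..1}|lebesgue. k t s * (g s - g (\<nu> s)))\<bar> =
          \<bar>LINT s:{0..1}|lebesgue. k t s * (u n s - (g s - g (\<nu> s)))\<bar>" by simp
      also have "\<dots> \<le> 1 / Suc n * (LINT s:{0..1}|lebesgue. \<bar>k t s\<bar>)"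
        using set_integral_diff(1)[OF i3[of n] i1]
        by (intro set_integral_mult_bound k t u) (simp add: right_diff_distrib)
      finally show ?thesis .
    qed
    have "(\<lambda>n. 1 / Suc n * (LINT s:{0..1}|lebesgue. \<bar>k t s\<bar>)) \<longlonglongrightarrow> 0"
      using LIMSEQ_inverse_real_of_nat by (intro tendsto_mult_left_zero) (simp add: inverse_eq_divide)
    then have "(\<lambda>n. F n t - (LINT s:{0..1}|lebesgue. k t s * (g s - g (\<nu> s)))) \<longlonglongrightarrow> 0"
      by (rule Lim_null_comparison[OF always_eventually, rotated]) (simp only: real_norm_def bound simp_thms)
    then show ?thesis by (rule LIM_zero_cancel)
  qed
  show ?thesis by (rule PhiBV_cball_lim[OF \<phi> always_eventually lim]) (simp_all only: F simp_thms)
qed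

subsection \<open>Functions of bounded variation\<close>

lemma non_overlapping_adjacent:
  fixes a b c d :: real
  assumes "b \<le> c"
  shows "non_overlapping {a..b} {c..d}" "non_overlapping {c..d} {a..b}"
proof -
  have "{a..b} \<inter> {c..d} = {} \<or> {a..b} \<inter> {c..d} = {c}" using assms by auto
  then show "non_overlapping {a..b} {c..d}" "non_overlapping {c..d} {a..b}"
    unfolding non_overlapping_def is_singleton_def by (auto simp: Int_commute)
qed

text \<open>Strictness of \<open>s < s'\<close> makes the new interval distinct from all members of
  \<open>Is\<close>, which end at or before \<open>s\<close>.\<close>

lemma interval_collections_append:
  assumes Is: "Is \<in> interval_collections" and le: "\<forall>p\<in>set Is. snd p \<le> s" and s: "0 \<le> s" "s < s'" "s' \<le> 1"
  shows "Is @ [(s, s')] \<in> interval_collections"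
proof -
  have "(s, s') \<notin> set Is" using le \<open>s < s'\<close> by auto
  moreover have "pairwise (\<lambda>(a, b) (c, d). non_overlapping {a..b} {c..d}) (insert (s, s') (set Is))"
    unfolding pairwise_insert
  proof (intro conjI ballI impI allI)
    show "pairwise (\<lambda>(a, b) (c, d). non_overlapping {a..b} {c..d}) (set Is)"
      using Is unfolding interval_collections_def by blast
  qed (use le in \<open>force intro: non_overlapping_adjacent\<close>)+
  ultimately show ?thesis using Is s unfolding interval_collections_def by auto
qed

lemma jordan_var_ge:
  assumes "Is \<in> interval_collections"
  shows "(\<Sum>n<length Is. ennreal \<bar>x (snd (Is ! n)) - x (fst (Is ! n))\<bar>) \<le> jordan_var x"
  unfolding jordan_var_def schramm_var_def by (rule SUP_upper[OF assms])

text \<open>The function \<open>v\<close> is the variation accumulated up to \<open>s\<close>.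
  Appending \<open>(s, s')\<close> to a collection ending by \<open>s\<close> gives the increment
  inequality, which makes \<open>v + x\<close> and \<open>v - x\<close> increasing.\<close>

lemma jordan_variation_function:
  assumes x: "jordan_var x \<le> ennreal C" and C: "0 \<le> C"
  obtains v where "\<And>s. s \<in> {0..1} \<Longrightarrow> 0 \<le> v s \<and> v s \<le> C"
    "\<And>s s'. 0 \<le> s \<Longrightarrow> s \<le> s' \<Longrightarrow> s' \<le> 1 \<Longrightarrow> v s + \<bar>x s' - x s\<bar> \<le> v s'"
proof -
  define A where "A s = {Is \<in> interval_collections. \<forall>p\<in>set Is. snd p \<le> s}" for s :: real
  define J where "J s = (SUP Is\<in>A s. \<Sum>n<length Is. ennreal \<bar>x (snd (Is ! n)) - x (fst (Is ! n))\<bar>)" for s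
  \<comment> \<open>Moving an added constant inside the supremum requires a nonempty index
    set.\<close>
  have ne: "A s \<noteq> {}" for s
  proof -
    have "[] \<in> A s" unfolding A_def interval_collections_def by simp
    then show ?thesis by blast
  qed
  have JC: "J s \<le> ennreal C" for s
  proof -
    have "J s \<le> jordan_var x" unfolding J_def
      by (rule SUP_least) (use jordan_var_ge[of _ x] in \<open>simp add: A_def del: sum_ennreal\<close>)
    then show ?thesis using x by (rule order_trans)
  qed
  have J: "J s + ennreal \<bar>x s' - x s\<bar> \<le> J s'" if s: "0 \<le> s" "s \<le> s'" "s' \<le> 1" for s s'
  proof (cases "s = s'")
    case False
    then have "s < s'" using s by simp
    have "(\<Sum>n<length Is. ennreal \<bar>x (snd (Is ! n)) - x (fst (Is ! n))\<bar>) + ennreal \<bar>x s' - x s\<bar> \<le> J s'"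
      if Is: "Is \<in> A s" for Is
    proof -
      have "Is @ [(s, s')] \<in> A s'"
        using Is interval_collections_append[OF _ _ s(1) \<open>s < s'\<close> s(3), of Is] \<open>s < s'\<close>
        unfolding A_def by fastforce
      then have "(\<Sum>n<length (Is @ [(s, s')]).
          ennreal \<bar>x (snd ((Is @ [(s, s')]) ! n)) - x (fst ((Is @ [(s, s')]) ! n))\<bar>) \<le> J s'"
        unfolding J_def by (rule SUP_upper)
      then show ?thesis by (simp add: nth_append)
    qed
    then show ?thesis unfolding J_def ennreal_SUP_add_left[OF ne, symmetric] by (rule SUP_least)
  qed simp
  define v where "v s = enn2real (J s)" for s
  have v: "J s = ennreal (v s)" for s
    using JC[of s] unfolding v_def by (simp add: ennreal_enn2real_if) (metis ennreal_less_top neq_top_trans order_less_irrefl)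
  have v0: "0 \<le> v s" for s unfolding v_def by simp
  show thesis
  proof (rule that)
    show "0 \<le> v s \<and> v s \<le> C" for s using v0 JC[of s] C unfolding v by simp
    show "v s + \<bar>x s' - x s\<bar> \<le> v s'" if "0 \<le> s" "s \<le> s'" "s' \<le> 1" for s s'
      using J[OF that] v0 unfolding v by (simp add: ennreal_plus[symmetric] del: ennreal_plus)
  qed
qed

lemma jordan_var_increment:
  assumes "s \<in> {0..1}"
  shows "ennreal \<bar>x s - x 0\<bar> \<le> jordan_var x"
proof -
  have "[(0, s)] \<in> interval_collections" using assms unfolding interval_collections_def by auto
  from jordan_var_ge[OF this, of x] show ?thesis by simp
qed

lemma BV_norm_le_1D:
  assumes x: "x \<in> BV" and n: "BV_norm x \<le> 1"
  shows "jordan_var x \<le> ennreal 1" "s \<in> {0..1} \<Longrightarrow> \<bar>x s\<bar> \<le> 1"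
proof -
  \<comment> \<open>Membership in \<open>BV\<close> supplies finiteness, which a bound on
    \<open>BV_norm\<close> alone does not: \<open>enn2real\<close> sends infinity to 0.\<close>
  obtain r where r: "r \<ge> 0" "jordan_var x = ennreal r"
    using x unfolding BV_def by (cases "jordan_var x") auto
  then have nr: "\<bar>x 0\<bar> + r \<le> 1" using n unfolding BV_norm_def by simp
  then show "jordan_var x \<le> ennreal 1" unfolding r(2) by (intro ennreal_leI) linarith
  show "\<bar>x s\<bar> \<le> 1" if "s \<in> {0..1}"
    using jordan_var_increment[OF that, of x] nr r by simp
qed

text \<open>At most one interval of a non-overlapping collection crosses a given point.\<close>

lemma interval_collections_crossing:
  assumes Is: "Is \<in> interval_collections"
    and P: "\<And>p q p' q'. P p q \<Longrightarrow> P p' q' \<Longrightarrow> \<exists>u v. u < v \<and> {u..v} \<subseteq> {p..q} \<inter> {p'..q'}"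
  shows "(\<Sum>n<length Is. of_bool (P (fst (Is ! n)) (snd (Is ! n)))) \<le> (1::real)"
proof -
  have "m = n" if mn: "m < length Is" "n < length Is" "P (fst (Is ! m)) (snd (Is ! m))" "P (fst (Is ! n)) (snd (Is ! n))" for m n
  proof (rule ccontr)
    assume "m \<noteq> n"
    then have "Is ! m \<noteq> Is ! n"
      using Is mn(1,2) unfolding interval_collections_def by (simp add: nth_eq_iff_index_eq)
    moreover have "pairwise (\<lambda>(a, b) (c, d). non_overlapping {a..b} {c..d}) (set Is)"
      using Is unfolding interval_collections_def by blast
    ultimately have no: "non_overlapping {fst (Is ! m)..snd (Is ! m)} {fst (Is ! n)..snd (Is ! n)}"
      using nth_mem[OF mn(1)] nth_mem[OF mn(2)] unfolding pairwise_def split_beta by blast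
    obtain u v where "u < v" "{u..v} \<subseteq> {fst (Is ! m)..snd (Is ! m)} \<inter> {fst (Is ! n)..snd (Is ! n)}"
      using P[OF mn(3,4)] by blast
    then have "u \<noteq> v" and "u \<in> {fst (Is ! m)..snd (Is ! m)} \<inter> {fst (Is ! n)..snd (Is ! n)}"
      "v \<in> {fst (Is ! m)..snd (Is ! m)} \<inter> {fst (Is ! n)..snd (Is ! n)}" by auto
    then show False using no unfolding non_overlapping_def is_singleton_def by (metis empty_iff singletonD)
  qed
  then have "card {n\<in>{..<length Is}. P (fst (Is ! n)) (snd (Is ! n))} \<le> Suc 0"
    by (subst card_le_Suc0_iff_eq) auto
  then show ?thesis by (simp add: of_bool_def sum.If_cases Int_def)
qed

text \<open>The function changes only on reaching \<open>a\<close> and on leaving \<open>b\<close>.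
  Each of these places is crossed by at most one interval of a collection, at cost at most
  \<open>c\<close>.\<close>

lemma jordan_var_indicator:
  assumes c: "0 \<le> c"
  shows "jordan_var (\<lambda>t\<in>{0..1}. c * indicator {a..b} t) \<le> ennreal (2 * c)"
  unfolding jordan_var_def schramm_var_def
proof (rule SUP_least)
  fix Is assume Is: "Is \<in> interval_collections"
  let ?x = "\<lambda>t\<in>{0..1}. c * indicator {a..b} t :: real"
  let ?p = "\<lambda>n. fst (Is ! n)" and ?q = "\<lambda>n. snd (Is ! n)"
  have "(\<Sum>n<length Is. \<bar>?x (?q n) - ?x (?p n)\<bar>)
      \<le> (\<Sum>n<length Is. c * of_bool (?p n < a \<and> a \<le> ?q n) + c * of_bool (?p n \<le> b \<and> b < ?q n))"
  proof (rule sum_mono)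
    fix n assume "n \<in> {..<length Is}"
    then have "0 \<le> ?p n" "?p n \<le> ?q n" "?q n \<le> 1"
      using interval_collections_endpoints[OF Is, of n] by auto
    then show "\<bar>?x (?q n) - ?x (?p n)\<bar> \<le> c * of_bool (?p n < a \<and> a \<le> ?q n) + c * of_bool (?p n \<le> b \<and> b < ?q n)"
      using c by (auto simp: indicator_def)
  qed
  also have "\<dots> = c * (\<Sum>n<length Is. of_bool (?p n < a \<and> a \<le> ?q n)) + c * (\<Sum>n<length Is. of_bool (?p n \<le> b \<and> b < ?q n))"
    by (simp only: sum.distrib sum_distrib_left)
  also have "\<dots> \<le> c * 1 + c * 1"
  proof (intro add_mono mult_left_mono c)
    have "\<exists>u v. u < v \<and> {u..v} \<subseteq> {p..q} \<inter> {p'..q'}" if "p < a \<and> a \<le> q" "p' < a \<and> a \<le> q'" for p q p' q' :: real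
      using that by (intro exI[of _ "max p p'"] exI[of _ a]) auto
    from interval_collections_crossing[OF Is, of "\<lambda>p q. p < a \<and> a \<le> q", OF this]
    show "(\<Sum>n<length Is. of_bool (?p n < a \<and> a \<le> ?q n)) \<le> (1::real)" .
    have "\<exists>u v. u < v \<and> {u..v} \<subseteq> {p..q} \<inter> {p'..q'}" if "p \<le> b \<and> b < q" "p' \<le> b \<and> b < q'" for p q p' q' :: real
      using that by (intro exI[of _ b] exI[of _ "min q q'"]) auto
    from interval_collections_crossing[OF Is, of "\<lambda>p q. p \<le> b \<and> b < q", OF this]
    show "(\<Sum>n<length Is. of_bool (?p n \<le> b \<and> b < ?q n)) \<le> (1::real)" .
  qed
  finally show "(\<Sum>n<length Is. ennreal \<bar>?x (?q n) - ?x (?p n)\<bar>) \<le> ennreal (2 * c)"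
    by (subst sum_ennreal) (auto intro: ennreal_leI)
qed

text \<open>The factor 1/4 leaves at most 1/4 for the value at 0 and 1/2 for the variation.\<close>

lemma indicator_in_BV_ball:
  "(\<lambda>t\<in>{0..1}. 1 / 4 * indicator {a..b} t) \<in> {x \<in> BV. BV_norm x \<le> 1}" (is "?x \<in> _")
proof -
  have le: "jordan_var ?x \<le> ennreal (2 * (1 / 4))" by (rule jordan_var_indicator) simp
  then have "?x \<in> BV" using le_less_trans[OF le ennreal_less_top] unfolding BV_def by auto
  have "enn2real (jordan_var ?x) \<le> 1 / 2"
    using enn2real_leI[OF _ le] by simp
  moreover have "\<bar>?x 0\<bar> \<le> 1 / 4" by (auto simp: indicator_def)
  ultimately have "\<bar>?x 0\<bar> + enn2real (jordan_var ?x) \<le> 1" by linarith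
  with \<open>?x \<in> BV\<close> show ?thesis unfolding BV_norm_def by blast
qed

subsection \<open>Compactness of the integral operator\<close>

text \<open>The criterion in terms of balls. Unlike the variation, the ball also bounds the value at
  \<open>t = 0\<close>, and it asks that every number above \<open>e\<close>, rather than
  \<open>e\<close> itself, be a level.\<close>

definition short_integrals :: "(nat \<Rightarrow> real \<Rightarrow> real) \<Rightarrow> (real \<Rightarrow> real \<Rightarrow> real) \<Rightarrow> real \<Rightarrow> real \<Rightarrow> bool" where
  "short_integrals \<phi> k d e \<longleftrightarrow> (\<forall>a b. 0 \<le> a \<and> a \<le> b \<and> b \<le> 1 \<and> b - a \<le> d \<longrightarrow>
      (\<lambda>t. LINT s:{a..b}|lebesgue. k t s) \<in> PhiBV_cball \<phi> e)"

text \<open>Writes \<open>x\<close> as a constant plus \<open>C * g - 2 * C * h\<close> with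
  \<open>g\<close> and \<open>h\<close> monotone into [0,1]. The constant cancels in
  \<open>x s - x (\<nu> s)\<close>, and the radii add up to
  \<open>C * e + 2 * C * e\<close>.\<close>

lemma jordan_integral_cball:
  assumes \<phi>: "schramm_sequence \<phi>"
    and k': "\<forall>t\<in>{0..1}. set_integrable lebesgue {0..1} (k t)"
    and E: "short_integrals \<phi> k d e" and d: "0 \<le> d"
    and \<nu>': "mono_on {0..1} \<nu>" "\<forall>s\<in>{0..1}. 0 \<le> \<nu> s \<and> \<nu> s \<le> s \<and> s \<le> \<nu> s + d"
    and x: "jordan_var x \<le> ennreal C" and C: "0 < C"
  shows "(\<lambda>t. LINT s:{0..1}|lebesgue. k t s * (x s - x (\<nu> s))) \<in> PhiBV_cball \<phi> (3 * C * e)"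
    and "t \<in> {0..1} \<Longrightarrow> set_integrable lebesgue {0..1} (\<lambda>s. k t s * x s)"
    and "t \<in> {0..1} \<Longrightarrow> set_integrable lebesgue {0..1} (\<lambda>s. k t s * x (\<nu> s))"
proof -
  note k = k'[rule_format]
  note \<nu> = \<nu>'(1) \<nu>'(2)[rule_format]
  obtain v where v: "\<And>s. s \<in> {0..1} \<Longrightarrow> 0 \<le> v s \<and> v s \<le> C"
    and inc: "\<And>s s'. 0 \<le> s \<Longrightarrow> s \<le> s' \<Longrightarrow> s' \<le> 1 \<Longrightarrow> v s + \<bar>x s' - x s\<bar> \<le> v s'"
    using jordan_variation_function[OF x less_imp_le[OF C]] by blast
  define g where "g s = v s / C" for s
  \<comment> \<open>The numerator lies between 0 and \<open>2 * C\<close>, because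
    \<open>\<bar>x s - x 0\<bar> \<le> v s \<le> C\<close>.\<close>
  define h where "h s = (v s - (x s - x 0)) / (2 * C)" for s
  have x_eq: "x s = x 0 + (C * g s - (2 * C) * h s)" for s
    unfolding g_def h_def using C by simp
  have g: "mono_on {0..1} g" "g s \<in> {0..1}" if "s \<in> {0..1}" for s
  proof -
    show "mono_on {0..1} g"
    proof (rule mono_onI)
      fix r s :: real assume "r \<in> {0..1}" "s \<in> {0..1}" "r \<le> s"
      then show "g r \<le> g s" using inc[of r s] C unfolding g_def by (intro divide_right_mono) auto
    qed
    show "g s \<in> {0..1}" using v[OF that] C unfolding g_def by auto
  qed
  have h: "mono_on {0..1} h" "h s \<in> {0..1}" if "s \<in> {0..1}" for s
  proof -
    show "mono_on {0..1} h"
    proof (rule mono_onI)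
      fix r s :: real assume "r \<in> {0..1}" "s \<in> {0..1}" "r \<le> s"
      then show "h r \<le> h s" using inc[of r s] C unfolding h_def by (intro divide_right_mono) auto
    qed
    show "h s \<in> {0..1}" using v[OF that] v[of 0] inc[of 0 s] that C unfolding h_def by auto
  qed
  \<comment> \<open>Monotonicity of \<open>g\<close> and \<open>h\<close> was stated under a premise
    on a point \<open>s\<close>; the point 0 discharges it.\<close>
  have one: "(0::real) \<in> {0..1}" by simp
  note g = g(1)[OF one] g(2) and h = h(1)[OF one] h(2)
  have \<nu>01: "\<nu> s \<in> {0..1}" if "s \<in> {0..1}" for s using \<nu>(2)[OF that] that by (auto elim: order_trans)
  have gh\<nu>: "mono_on {0..1} (\<lambda>s. g (\<nu> s))" "mono_on {0..1} (\<lambda>s. h (\<nu> s))"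
    by (intro mono_onI mono_onD[OF g(1)] mono_onD[OF h(1)] mono_onD[OF \<nu>(1)] \<nu>01; assumption)+
  have comb: "set_integrable lebesgue {0..1} (\<lambda>s. k t s * (x 0 + (C * p s - (2 * C) * q s)))"
    if t: "t \<in> {0..1}" and p: "mono_on {0..1} p" and q: "mono_on {0..1} q" for t p q
  proof -
    have "set_integrable lebesgue {0..1} (\<lambda>s. k t s * x 0 + (C * (k t s * p s) - (2 * C) * (k t s * q s)))"
      by (intro set_integral_add set_integral_diff set_integrable_mult_left set_integrable_mult_right
          set_integrable_mult_mono_on k t p q)
    then show ?thesis by (simp add: algebra_simps)
  qed
  show "set_integrable lebesgue {0..1} (\<lambda>s. k t s * x s)" if "t \<in> {0..1}"
    using comb[OF that g(1) h(1)] unfolding x_eq[symmetric] .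
  show "set_integrable lebesgue {0..1} (\<lambda>s. k t s * x (\<nu> s))" if "t \<in> {0..1}"
    using comb[OF that gh\<nu>] unfolding x_eq[symmetric] .
  note K = mono_on_integral_cball[OF \<phi> k' E[unfolded short_integrals_def] d]
  have G: "(\<lambda>t. LINT s:{0..1}|lebesgue. k t s * (g s - g (\<nu> s))) \<in> PhiBV_cball \<phi> e"
    by (rule K) (use g \<nu> in auto)
  have H: "(\<lambda>t. LINT s:{0..1}|lebesgue. k t s * (h s - h (\<nu> s))) \<in> PhiBV_cball \<phi> e"
    by (rule K) (use h \<nu> in auto)
  have "(\<lambda>t. C * (LINT s:{0..1}|lebesgue. k t s * (g s - g (\<nu> s))) -
      (2 * C) * (LINT s:{0..1}|lebesgue. k t s * (h s - h (\<nu> s)))) \<in> PhiBV_cball \<phi> (C * e + (2 * C) * e)"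
    using C by (intro PhiBV_cball_diff[OF \<phi>] PhiBV_cball_scale[OF \<phi> G] PhiBV_cball_scale[OF \<phi> H]) auto
  then have "(\<lambda>t. C * (LINT s:{0..1}|lebesgue. k t s * (g s - g (\<nu> s))) -
      (2 * C) * (LINT s:{0..1}|lebesgue. k t s * (h s - h (\<nu> s)))) \<in> PhiBV_cball \<phi> (3 * C * e)"
    by (rule PhiBV_cball_mono) simp
  then show "(\<lambda>t. LINT s:{0..1}|lebesgue. k t s * (x s - x (\<nu> s))) \<in> PhiBV_cball \<phi> (3 * C * e)"
  proof (rule PhiBV_cball_cong)
    fix t :: real assume t: "t \<in> {0..1}"
    have "set_integrable lebesgue {0..1} (\<lambda>s. k t s * (p s - p (\<nu> s)))"
      if "mono_on {0..1} p" "mono_on {0..1} (\<lambda>s. p (\<nu> s))" for p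
      unfolding right_diff_distrib by (intro set_integral_diff set_integrable_mult_mono_on k t that)
    note i = this[OF g(1) gh\<nu>(1)] this[OF h(1) gh\<nu>(2)]
    have "k t s * (x s - x (\<nu> s)) = C * (k t s * (g s - g (\<nu> s))) - (2 * C) * (k t s * (h s - h (\<nu> s)))" for s
      by (subst (1 2) x_eq) (simp add: algebra_simps)
    then have "(LINT s:{0..1}|lebesgue. k t s * (x s - x (\<nu> s))) =
        (LINT s:{0..1}|lebesgue. C * (k t s * (g s - g (\<nu> s))) - (2 * C) * (k t s * (h s - h (\<nu> s))))"
      by (simp only:)
    also have "\<dots> = C * (LINT s:{0..1}|lebesgue. k t s * (g s - g (\<nu> s))) -
      (2 * C) * (LINT s:{0..1}|lebesgue. k t s * (h s - h (\<nu> s)))"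
      using i by (subst set_integral_diff(2)) simp_all
    finally show "(LINT s:{0..1}|lebesgue. k t s * (x s - x (\<nu> s))) =
        C * (LINT s:{0..1}|lebesgue. k t s * (g s - g (\<nu> s))) -
      (2 * C) * (LINT s:{0..1}|lebesgue. k t s * (h s - h (\<nu> s)))" .
  qed
qed

text \<open>The functions \<open>c i\<close> are the images of the indicators of the grid cells, so
  the sum is the image of the step function \<open>x (\<nu> s)\<close>. They and \<open>N\<close>
  are chosen before \<open>x\<close>, which makes the approximation uniform over bounded
  variation.\<close>

lemma integral_operator_step_approximation:
  assumes \<phi>: "schramm_sequence \<phi>"
    and k': "\<forall>t\<in>{0..1}. set_integrable lebesgue {0..1} (k t)"
    and E: "short_integrals \<phi> k d e" and d: "0 < d"
  shows "\<exists>N c. (\<forall>i. c i \<in> PhiBV_cball \<phi> e) \<and>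
    (\<forall>x C. 0 < C \<longrightarrow> jordan_var x \<le> ennreal C \<longrightarrow>
      (\<lambda>t. integral_operator k x t - (\<Sum>i\<le>N. x (real i / real N) * c i t)) \<in> PhiBV_cball \<phi> (3 * C * e))"
proof -
  note k = k'[rule_format]
  obtain N :: nat where N: "N > 0" "1 / real N < d"
    using iffD1[OF real_arch_inverse d] by (auto simp: inverse_eq_divide)
  define \<nu> where "\<nu> s = real_of_int \<lfloor>real N * s\<rfloor> / real N" for s :: real
  have \<nu>: "mono_on {0..1} \<nu>" "\<And>s. s \<in> {0..1} \<Longrightarrow> 0 \<le> \<nu> s \<and> \<nu> s \<le> s \<and> s \<le> \<nu> s + d"
  proof -
    show "mono_on {0..1} \<nu>"
      unfolding \<nu>_def by (intro mono_onI divide_right_mono) (auto intro!: floor_mono mult_left_mono)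
    fix s :: real assume "s \<in> {0..1}"
    then have "0 \<le> \<nu> s" "\<nu> s \<le> s" "s \<le> \<nu> s + 1 / real N"
      using N(1) unfolding \<nu>_def by (auto simp: divide_simps mult.commute)+
    then show "0 \<le> \<nu> s \<and> \<nu> s \<le> s \<and> s \<le> \<nu> s + d" using N by auto
  qed
  have \<nu>': "\<forall>s\<in>{0..1}. 0 \<le> \<nu> s \<and> \<nu> s \<le> s \<and> s \<le> \<nu> s + d" using \<nu>(2) by blast
  \<comment> \<open>The last cell \<open>A N\<close> is the single point 1, which is why the sum
    runs up to \<open>N\<close> inclusive.\<close>
  define A where "A i = {s\<in>{0..1}. \<lfloor>real N * s\<rfloor> = int i}" for i :: nat
  define c where "c i t = (LINT s:A i|lebesgue. k t s)" for i t
  have A: "A i \<in> sets lebesgue" "c i \<in> PhiBV_cball \<phi> e" for i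
  proof -
    have 1: "A i \<subseteq> {0..1}" unfolding A_def by auto
    have 2: "is_interval (A i)"
      unfolding is_interval_1
    proof clarify
      fix x z y assume *: "x \<in> A i" "z \<in> A i" "x \<le> y" "y \<le> z"
      then have "\<lfloor>real N * x\<rfloor> \<le> \<lfloor>real N * y\<rfloor>" "\<lfloor>real N * y\<rfloor> \<le> \<lfloor>real N * z\<rfloor>"
        by (auto intro!: floor_mono mult_left_mono)
      then show "y \<in> A i" using * unfolding A_def by auto
    qed
    have 3: "\<forall>x\<in>A i. \<forall>y\<in>A i. y \<le> x + d"
    proof clarify
      fix x y assume "x \<in> A i" "y \<in> A i"
      then have "\<nu> x = \<nu> y" "x \<in> {0..1}" "y \<in> {0..1}" unfolding A_def \<nu>_def by auto
      then show "y \<le> x + d" using \<nu>(2)[of x] \<nu>(2)[of y] by auto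
    qed
    show "A i \<in> sets lebesgue" "c i \<in> PhiBV_cball \<phi> e"
      using interval_integral_cball[OF k' E[unfolded short_integrals_def] 1 2 less_imp_le[OF d] 3]
      unfolding c_def by auto
  qed
  show ?thesis
  proof (intro exI conjI allI impI)
    show "c i \<in> PhiBV_cball \<phi> e" for i by (rule A(2))
    fix x C assume C: "0 < C" and x: "jordan_var x \<le> ennreal C"
    note J = jordan_integral_cball[OF \<phi> k' E less_imp_le[OF d] \<nu>(1) \<nu>' x C]
    show "(\<lambda>t. integral_operator k x t - (\<Sum>i\<le>N. x (real i / real N) * c i t)) \<in> PhiBV_cball \<phi> (3 * C * e)"
    proof (rule PhiBV_cball_cong[OF J(1)])
      fix t :: real assume t: "t \<in> {0..1}"
      have xs: "x (\<nu> s) = (\<Sum>i\<le>N. x (real i / real N) * indicator (A i) s)" if s: "s \<in> {0..1}" for s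
      proof -
        define j where "j = nat \<lfloor>real N * s\<rfloor>"
        have j: "\<lfloor>real N * s\<rfloor> = int j" using s unfolding j_def by simp
        have "real N * s \<le> real N" using s by (simp add: mult_left_le)
        then have "j \<le> N" unfolding j_def by (simp add: nat_le_iff floor_le_iff)
        have "(\<Sum>i\<le>N. x (real i / real N) * indicator (A i) s) = (\<Sum>i\<le>N. if i = j then x (real i / real N) else 0)"
          using s j by (intro sum.cong) (auto simp: A_def indicator_def)
        also have "\<dots> = x (real j / real N)" using \<open>j \<le> N\<close> by simp
        finally show ?thesis unfolding \<nu>_def j by simp
      qed
      have "(LINT s:{0..1}|lebesgue. k t s * x (\<nu> s)) =
          (LINT s:{0..1}|lebesgue. (\<Sum>i\<le>N. x (real i / real N) * (k t s * indicator (A i) s)))"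
      proof (intro set_lebesgue_integral_cong allI impI)
        fix s :: real assume "s \<in> {0..1}"
        then show "k t s * x (\<nu> s) = (\<Sum>i\<le>N. x (real i / real N) * (k t s * indicator (A i) s))"
          unfolding xs[OF \<open>s \<in> {0..1}\<close>] sum_distrib_left by (intro sum.cong refl mult.left_commute)
      qed simp
      also have "\<dots> = (\<Sum>i\<le>N. LINT s:{0..1}|lebesgue. x (real i / real N) * (k t s * indicator (A i) s))"
        by (intro set_integral_sum set_integrable_mult_right set_integrable_mult_indicator k t A)
      also have "\<dots> = (\<Sum>i\<le>N. x (real i / real N) * c i t)"
        unfolding c_def set_integral_mult_right
        by (intro sum.cong refl arg_cong2[where f = "(*)"] set_integral_unit_indicator[symmetric]) (auto simp: A_def)
      finally have "(\<Sum>i\<le>N. x (real i / real N) * c i t) = (LINT s:{0..1}|lebesgue. k t s * x (\<nu> s))" ..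
      moreover have "integral_operator k x t = (LINT s:{0..1}|lebesgue. k t s * x s)"
        using t unfolding integral_operator_def by simp
      ultimately show "integral_operator k x t - (\<Sum>i\<le>N. x (real i / real N) * c i t) =
          (LINT s:{0..1}|lebesgue. k t s * (x s - x (\<nu> s)))"
        unfolding right_diff_distrib using J(2,3)[OF t] by (simp only: set_integral_diff(2))
    qed
  qed
qed

text \<open>A single scale \<open>e\<close> suffices: the approximation error lies in some ball, and
  so does the finite sum approximating the image.\<close>

lemma integral_operator_PhiBV:
  assumes \<phi>: "schramm_sequence \<phi>"
    and k: "\<forall>t\<in>{0..1}. set_integrable lebesgue {0..1} (k t)"
    and E: "short_integrals \<phi> k d e" "0 < d" and x: "x \<in> BV"
  shows "integral_operator k x \<in> PhiBV \<phi>"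
proof -
  obtain N :: nat and c where Nc: "(\<forall>i. c i \<in> PhiBV_cball \<phi> e) \<and>
    (\<forall>x C. 0 < C \<longrightarrow> jordan_var x \<le> ennreal C \<longrightarrow>
      (\<lambda>t. integral_operator k x t - (\<Sum>i\<le>N. x (real i / real N) * c i t)) \<in> PhiBV_cball \<phi> (3 * C * e))"
    using integral_operator_step_approximation[OF \<phi> k E] by (elim exE)
  note c = conjunct1[OF Nc, rule_format] and app = conjunct2[OF Nc, rule_format]
  obtain r where r: "r \<ge> 0" "jordan_var x = ennreal r"
    using x unfolding BV_def by (cases "jordan_var x") auto
  have sum: "(\<lambda>t. \<Sum>i\<le>N. x (real i / real N) * c i t) \<in> PhiBV_cball \<phi> (\<Sum>i\<le>N. \<bar>x (real i / real N)\<bar> * e)"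
    by (intro PhiBV_cball_sum[OF \<phi>] PhiBV_cball_scale[OF \<phi> c]) auto
  \<comment> \<open>The approximation asks for a positive bound, while the variation
    \<open>r\<close> may be 0; hence \<open>r + 1\<close>.\<close>
  have "(\<lambda>t. integral_operator k x t - (\<Sum>i\<le>N. x (real i / real N) * c i t)) \<in> PhiBV_cball \<phi> (3 * (r + 1) * e)"
    using r by (intro app) (auto intro: ennreal_leI)
  from PhiBV_cball_add[OF \<phi> this sum] have "\<exists>b. integral_operator k x \<in> PhiBV_cball \<phi> b" by auto
  then show ?thesis unfolding PhiBV_iff_cball[OF \<phi>] by (simp add: integral_operator_def)
qed

text \<open>Rounding the values of \<open>x\<close> at the grid points \<open>i / N\<close> to multiples of \<open>1 / (N + 1)\<close> leaves
  finitely many classes, and the images of functions in the same class are close.\<close>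

lemma mtotally_bounded_integral_operator:
  assumes \<phi>: "schramm_sequence \<phi>"
    and k: "\<forall>t\<in>{0..1}. set_integrable lebesgue {0..1} (k t)"
    and E: "\<forall>e>0. \<exists>d>0. short_integrals \<phi> k d e"
  shows "Metric_space.mtotally_bounded (PhiBV \<phi>) (PhiBV_dist \<phi>)
    (integral_operator k ` {x \<in> BV. BV_norm x \<le> 1})"
proof -
  interpret Metric_space "PhiBV \<phi>" "PhiBV_dist \<phi>" by (rule Metric_space_PhiBV[OF \<phi>])
  let ?B = "{x \<in> BV. BV_norm x \<le> 1}" and ?T = "integral_operator k"
  have T: "?T x \<in> PhiBV \<phi>" if "x \<in> BV" for x
    using E[rule_format, of 1] integral_operator_PhiBV[OF \<phi> k _ _ that] by auto
  show ?thesis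
    unfolding mtotally_bounded_def
  proof (intro allI impI)
    fix \<epsilon> :: real assume \<epsilon>: "\<epsilon> > 0"
    \<comment> \<open>Two approximation errors \<open>3 * e\<close> and a coefficient error
      \<open>e\<close> give radius \<open>7 * e\<close>; the factor 2 between balls and distance
      gives \<open>14 * e < \<epsilon>\<close>.\<close>
    define e where "e = \<epsilon> / 15"
    have e: "e > 0" using \<epsilon> by (simp add: e_def)
    obtain d where d: "short_integrals \<phi> k d e" "0 < d" using E e by blast
    obtain N :: nat and c where Nc: "(\<forall>i. c i \<in> PhiBV_cball \<phi> e) \<and>
    (\<forall>x C. 0 < C \<longrightarrow> jordan_var x \<le> ennreal C \<longrightarrow>
      (\<lambda>t. integral_operator k x t - (\<Sum>i\<le>N. x (real i / real N) * c i t)) \<in> PhiBV_cball \<phi> (3 * C * e))"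
    using integral_operator_step_approximation[OF \<phi> k d] by (elim exE)
  note c = conjunct1[OF Nc, rule_format] and app = conjunct2[OF Nc, rule_format]
    \<comment> \<open>There are \<open>N + 1\<close> coefficients, so rounding to mesh
      \<open>1 / (N + 1)\<close> keeps their total contribution within \<open>e\<close>.\<close>
    define code where "code x = (\<lambda>i\<in>{..N}. \<lfloor>real (Suc N) * x (real i / real N)\<rfloor>)" for x :: "real \<Rightarrow> real"
    have code: "code x \<in> {..N} \<rightarrow>\<^sub>E {- int (Suc N)..int (Suc N)}" if x: "x \<in> ?B" for x
    proof -
      have "\<lfloor>real (Suc N) * x (real i / real N)\<rfloor> \<in> {- int (Suc N)..int (Suc N)}" if i: "i \<le> N" for i
      proof -
        have "real i / real N \<in> {0..1}" using i by (auto simp: divide_le_eq_1)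
        then have "\<bar>x (real i / real N)\<bar> \<le> 1" using x BV_norm_le_1D(2) by blast
        then have "\<bar>real (Suc N) * x (real i / real N)\<bar> \<le> real (Suc N)"
          unfolding abs_mult by (simp add: mult_left_le)
        then show ?thesis by (auto simp only: atLeastAtMost_iff le_floor_iff floor_le_iff abs_le_iff of_int_minus of_int_of_nat_eq)
      qed
      then show ?thesis unfolding code_def by auto
    qed
    have "finite (code ` ?B)"
      by (rule finite_subset[of _ "{..N} \<rightarrow>\<^sub>E {- int (Suc N)..int (Suc N)}"])
         (use code in \<open>auto intro: finite_PiE\<close>)
    moreover have close: "PhiBV_dist \<phi> (?T x) (?T y) < \<epsilon>" if x: "x \<in> ?B" and y: "y \<in> ?B" and xy: "code x = code y" for x y
    proof -
      have le: "\<bar>x (real i / real N) - y (real i / real N)\<bar> \<le> 1 / real (Suc N)" if "i \<le> N" for i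
      proof -
        have "\<lfloor>real (Suc N) * x (real i / real N)\<rfloor> = \<lfloor>real (Suc N) * y (real i / real N)\<rfloor>"
          using fun_cong[OF xy, of i] that unfolding code_def by simp
        then have "\<bar>real (Suc N) * (x (real i / real N) - y (real i / real N))\<bar> \<le> 1"
          unfolding right_diff_distrib by linarith
        then show ?thesis unfolding abs_mult by (simp add: field_simps)
      qed
      have "\<bar>x (real i / real N) - y (real i / real N)\<bar> * e \<le> 1 / real (Suc N) * e" if "i \<le> N" for i
        using le[OF that] e by (intro mult_right_mono) auto
      then have sum: "(\<lambda>t. \<Sum>i\<le>N. (x (real i / real N) - y (real i / real N)) * c i t)
          \<in> PhiBV_cball \<phi> (\<Sum>i\<le>N. 1 / real (Suc N) * e)"
        by (intro PhiBV_cball_sum[OF \<phi>] PhiBV_cball_scale[OF \<phi> c]) auto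
      have "jordan_var x \<le> ennreal 1" "jordan_var y \<le> ennreal 1"
        using x y BV_norm_le_1D(1) by blast+
      note PhiBV_cball_diff[OF \<phi> app[OF zero_less_one this(1)] app[OF zero_less_one this(2)]]
      from PhiBV_cball_add[OF \<phi> this sum]
      have "(\<lambda>t. ?T x t - ?T y t) \<in> PhiBV_cball \<phi> (3 * 1 * e + 3 * 1 * e + (\<Sum>i\<le>N. 1 / real (Suc N) * e))"
        by (rule PhiBV_cball_cong) (simp add: left_diff_distrib sum_subtractf)
      moreover have "3 * 1 * e + 3 * 1 * e + (\<Sum>i\<le>N. 1 / real (Suc N) * e) = 7 * e" by simp
      ultimately have "(\<lambda>t. ?T x t - ?T y t) \<in> PhiBV_cball \<phi> (7 * e)" by simp
      from PhiBV_dist_le[OF T T this] x y show ?thesis using \<epsilon> by (simp add: e_def)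
    qed
    ultimately show "\<exists>K. finite K \<and> K \<subseteq> ?T ` ?B \<and> ?T ` ?B \<subseteq> (\<Union>x\<in>K. mball x \<epsilon>)"
    proof (intro exI conjI)
      \<comment> \<open>The centres of the net must lie in the image itself, so each occurring code
        is represented by a chosen member of the unit ball.\<close>
      let ?r = "\<lambda>p. SOME x. x \<in> ?B \<and> code x = p"
      have r: "?r (code x) \<in> ?B \<and> code (?r (code x)) = code x" if "x \<in> ?B" for x
        by (rule someI[of "\<lambda>y. y \<in> ?B \<and> code y = code x" x]) (use that in blast)
      show "(\<lambda>p. ?T (?r p)) ` code ` ?B \<subseteq> ?T ` ?B" using r by blast
      show "?T ` ?B \<subseteq> (\<Union>x\<in>(\<lambda>p. ?T (?r p)) ` code ` ?B. mball x \<epsilon>)"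
      proof
        fix z assume "z \<in> ?T ` ?B"
        then obtain x where x: "x \<in> ?B" "z = ?T x" by blast
        have "z \<in> mball (?T (?r (code x))) \<epsilon>"
          using close[of "?r (code x)" x] r[OF x(1)] x T unfolding in_mball by blast
        then show "z \<in> (\<Union>x\<in>(\<lambda>p. ?T (?r p)) ` code ` ?B. mball x \<epsilon>)" using x(1) by blast
      qed
    qed (rule finite_imageI)
  qed
qed

section \<open>Necessity of the criterion\<close>

lemma compact_operator_imp_short_integrals:
  assumes \<phi>: "schramm_sequence \<phi>"
    and k': "\<forall>t\<in>{0..1}. set_integrable lebesgue {0..1} (k t)"
    and maps: "integral_operator k ` BV \<subseteq> PhiBV \<phi>"
    and comp: "compact_operator \<phi> (integral_operator k)" and \<epsilon>: "\<epsilon> > 0"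
  shows "\<exists>d>0. \<forall>a b. 0 \<le> a \<and> a \<le> b \<and> b \<le> 1 \<and> b - a \<le> d \<longrightarrow>
      \<epsilon> \<in> PhiBV_levels \<phi> (\<lambda>t. LINT s:{a..b}|lebesgue. k t s)"
proof (rule ccontr)
  note k = k'[rule_format]
  interpret Metric_space "PhiBV \<phi>" "PhiBV_dist \<phi>" by (rule Metric_space_PhiBV[OF \<phi>])
  let ?B = "{x \<in> BV. BV_norm x \<le> 1}" and ?T = "integral_operator k"
  assume "\<not> ?thesis"
  then have "\<exists>a b. 0 \<le> a \<and> a \<le> b \<and> b \<le> 1 \<and> b - a \<le> inverse (real (Suc n)) \<and>
      \<epsilon> \<notin> PhiBV_levels \<phi> (\<lambda>t. LINT s:{a..b}|lebesgue. k t s)" for n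
    by (meson inverse_positive_iff_positive of_nat_0_less_iff zero_less_Suc)
  then obtain a b where ab: "\<And>n. 0 \<le> a n" "\<And>n. a n \<le> b n" "\<And>n. b n \<le> 1"
      "\<And>n. b n - a n \<le> inverse (real (Suc n))"
    and no: "\<And>n. \<epsilon> \<notin> PhiBV_levels \<phi> (\<lambda>t. LINT s:{a n..b n}|lebesgue. k t s)"
    by metis
  \<comment> \<open>The factor 1/4 places the indicators in the unit ball; it is undone at the end
    by multiplying by 4.\<close>
  define \<sigma> where "\<sigma> n = ?T (\<lambda>t\<in>{0..1}. 1 / 4 * indicator {a n..b n} t)" for n
  have \<sigma>: "\<sigma> n t = 1 / 4 * (LINT s:{a n..b n}|lebesgue. k t s)" if "t \<in> {0..1}" for n t
  proof -
    have "\<sigma> n t = (LINT s:{0..1}|lebesgue. 1 / 4 * (k t s * indicator {a n..b n} s))"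
      using that unfolding \<sigma>_def integral_operator_def restrict_apply'[OF that]
      by (intro set_lebesgue_integral_cong) simp_all
    also have "\<dots> = 1 / 4 * (LINT s:{a n..b n}|lebesgue. k t s)"
      unfolding set_integral_mult_right
      by (subst set_integral_unit_indicator[of "{a n..b n}"]) (use ab(1)[of n] ab(3)[of n] in auto)
    finally show ?thesis .
  qed
  have "\<sigma> n \<in> ?T ` ?B" for n unfolding \<sigma>_def by (rule imageI[OF indicator_in_BV_ball])
  moreover have TB: "?T ` ?B \<subseteq> PhiBV \<phi>" using maps by blast
  ultimately have "range \<sigma> \<subseteq> mtopology closure_of (?T ` ?B)"
    using closure_of_subset[of "?T ` ?B" mtopology] by auto
  moreover have "compactin mtopology (mtopology closure_of (?T ` ?B))"
    using comp unfolding compact_operator_def PhiBV_topology_def .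
  ultimately obtain l r where r: "strict_mono r" and lim: "limitin mtopology (\<sigma> \<circ> r) l sequentially"
    unfolding compactin_sequentially by meson
  have l: "l \<in> PhiBV \<phi>" and near: "\<forall>\<^sub>F n in sequentially. (\<lambda>t. \<sigma> (r n) t - l t) \<in> PhiBV_cball \<phi> e" if "e > 0" for e
  proof -
    show l: "l \<in> PhiBV \<phi>" using lim unfolding limitin_metric by blast
    have "\<forall>\<^sub>F n in sequentially. (\<sigma> \<circ> r) n \<in> PhiBV \<phi> \<and> PhiBV_dist \<phi> ((\<sigma> \<circ> r) n) l < e"
      using lim that unfolding limitin_metric by blast
    then show "\<forall>\<^sub>F n in sequentially. (\<lambda>t. \<sigma> (r n) t - l t) \<in> PhiBV_cball \<phi> e"
      by eventually_elim (use PhiBV_dist_less_imp_cball[OF \<phi> _ l] in simp)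
  qed
  obtain C where C: "C > 0" "\<And>f c t. f \<in> PhiBV_cball \<phi> c \<Longrightarrow> t \<in> {0..1} \<Longrightarrow> \<bar>f t\<bar> \<le> C * c"
    using PhiBV_cball_pointwise[OF \<phi>] by blast
  \<comment> \<open>The values of the subsequence at \<open>t\<close> tend to \<open>l t\<close> by
    norm convergence, and to 0 by absolute continuity of the integral of \<open>k t\<close>.\<close>
  have l0: "l t = 0" if t: "t \<in> {0..1}" for t
  proof (rule LIMSEQ_unique)
    show "(\<lambda>n. \<sigma> (r n) t) \<longlonglongrightarrow> l t"
    proof (rule tendstoI)
      fix e :: real assume "e > 0"
      then have "\<forall>\<^sub>F n in sequentially. (\<lambda>t. \<sigma> (r n) t - l t) \<in> PhiBV_cball \<phi> (e / (2 * C))"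
        using C(1) by (intro near) simp
      then show "\<forall>\<^sub>F n in sequentially. dist (\<sigma> (r n) t) (l t) < e"
      proof eventually_elim
        case (elim n)
        from C(2)[OF this t] show ?case using C(1) \<open>e > 0\<close> by (simp add: dist_real_def)
      qed
    qed
    show "(\<lambda>n. \<sigma> (r n) t) \<longlonglongrightarrow> 0"
    proof (rule tendstoI)
      fix e :: real assume e: "e > 0"
      obtain d where d: "d > 0" "\<And>a b. 0 \<le> a \<Longrightarrow> a \<le> b \<Longrightarrow> b \<le> 1 \<Longrightarrow> b - a \<le> d \<Longrightarrow>
          \<bar>LINT s:{a..b}|lebesgue. k t s\<bar> \<le> e"
        using set_integral_short_interval[OF k[OF t] e] by blast
      have "\<forall>\<^sub>F n in sequentially. inverse (real (Suc n)) < d"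
        by (rule order_tendstoD(2)[OF LIMSEQ_inverse_real_of_nat d(1)])
      then show "\<forall>\<^sub>F n in sequentially. dist (\<sigma> (r n) t) 0 < e"
      proof eventually_elim
        case (elim n)
        have "inverse (real (Suc (r n))) \<le> inverse (real (Suc n))"
          using strict_mono_imp_increasing[OF r, of n] by simp
        then have "b (r n) - a (r n) \<le> d" using ab(4)[of "r n"] elim by linarith
        from d(2)[OF ab(1-3) this] show ?case unfolding \<sigma>[OF t] using e by (simp add: dist_real_def)
      qed
    qed
  qed
  \<comment> \<open>Multiplication by 4 yields radius \<open>\<epsilon> / 2\<close>, strictly below
    \<open>\<epsilon>\<close>, so \<open>\<epsilon>\<close> itself is a level.\<close>
  have "\<forall>\<^sub>F n in sequentially. (\<lambda>t. \<sigma> (r n) t - l t) \<in> PhiBV_cball \<phi> (\<epsilon> / 8)" using near \<epsilon> by simp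
  then obtain n where "(\<lambda>t. \<sigma> (r n) t - l t) \<in> PhiBV_cball \<phi> (\<epsilon> / 8)"
    using eventually_happens'[OF sequentially_bot] by blast
  then have "(\<lambda>t. 4 * (\<sigma> (r n) t - l t)) \<in> PhiBV_cball \<phi> (\<epsilon> / 2)"
    by (rule PhiBV_cball_scale[OF \<phi>]) simp
  then have "(\<lambda>t. LINT s:{a (r n)..b (r n)}|lebesgue. k t s) \<in> PhiBV_cball \<phi> (\<epsilon> / 2)"
    by (rule PhiBV_cball_cong) (simp add: \<sigma> l0)
  then have "\<epsilon> \<in> PhiBV_levels \<phi> (\<lambda>t. LINT s:{a (r n)..b (r n)}|lebesgue. k t s)"
    using \<epsilon> unfolding PhiBV_cball_def by simp
  then show False using no by blast
qed

theorem theorem14: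
  fixes \<phi> :: "nat \<Rightarrow> real \<Rightarrow> real" and k :: "real \<Rightarrow> real \<Rightarrow> real"
  assumes "schramm_sequence \<phi>"
    and "\<And>t. t \<in> {0..1} \<Longrightarrow> set_integrable lebesgue {0..1} (k t)"
  shows "(integral_operator k ` BV \<subseteq> PhiBV \<phi> \<and> compact_operator \<phi> (integral_operator k)) \<longleftrightarrow>
    (\<forall>\<epsilon>>0. \<exists>\<delta>>0. \<forall>a b. 0 \<le> a \<and> a \<le> b \<and> b \<le> 1 \<and> b - a \<le> \<delta> \<longrightarrow>
       schramm_var \<phi> (\<lambda>t. inverse \<epsilon> * (LINT s:{a..b}|lebesgue. k t s)) \<le> 1)"
  (is "?lhs \<longleftrightarrow> ?rhs")
proof
  have k: "\<forall>t\<in>{0..1}. set_integrable lebesgue {0..1} (k t)" using assms(2) by blast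
  assume ?lhs
  then show ?rhs
    using compact_operator_imp_short_integrals[OF assms(1) k] unfolding PhiBV_levels_def by simp
next
  have k: "\<forall>t\<in>{0..1}. set_integrable lebesgue {0..1} (k t)" using assms(2) by blast
  assume rhs: ?rhs
  have E: "\<forall>e>0. \<exists>d>0. short_integrals \<phi> k d e"
  proof (intro allI impI)
    fix e :: real assume e: "e > 0"
    obtain d1 where d1: "d1 > 0" "\<And>a b. 0 \<le> a \<Longrightarrow> a \<le> b \<Longrightarrow> b \<le> 1 \<Longrightarrow> b - a \<le> d1 \<Longrightarrow>
        schramm_var \<phi> (\<lambda>t. inverse e * (LINT s:{a..b}|lebesgue. k t s)) \<le> 1"
      using rhs e by meson
    \<comment> \<open>The variation ignores additive constants, so the bound at \<open>t = 0\<close>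
      demanded by the balls comes from integrability of \<open>k 0\<close>, at the price of
      shrinking the admissible length.\<close>
    have "set_integrable lebesgue {0..1} (k 0)" using assms(2)[of 0] by simp
    then obtain d0 where d0: "d0 > 0" "\<And>a b. 0 \<le> a \<Longrightarrow> a \<le> b \<Longrightarrow> b \<le> 1 \<Longrightarrow> b - a \<le> d0 \<Longrightarrow>
        \<bar>LINT s:{a..b}|lebesgue. k 0 s\<bar> \<le> e"
      using set_integral_short_interval[OF _ e] by blast
    have "short_integrals \<phi> k (min d0 d1) e"
      unfolding short_integrals_def
      by (intro allI impI PhiBV_cballI_level[OF assms(1)]) (use d0 d1 e in \<open>simp_all add: PhiBV_levels_def\<close>)
    then show "\<exists>d>0. short_integrals \<phi> k d e" using d0 d1 by (intro exI[of _ "min d0 d1"]) simp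
  qed
  obtain d where "short_integrals \<phi> k d 1" "0 < d" using E[rule_format, of 1] by auto
  then have "integral_operator k ` BV \<subseteq> PhiBV \<phi>"
    using integral_operator_PhiBV[OF assms(1) k] by blast
  \<comment> \<open>In a complete metric space a totally bounded subset has compact closure.\<close>
  moreover have "compact_operator \<phi> (integral_operator k)"
  proof -
    interpret Metric_space "PhiBV \<phi>" "PhiBV_dist \<phi>" by (rule Metric_space_PhiBV[OF assms(1)])
    show ?thesis
      using mtotally_bounded_integral_operator[OF assms(1) k E]
        mtotally_bounded_eq_compact_closure_of[OF mcomplete_PhiBV[OF assms(1)]]
      unfolding compact_operator_def PhiBV_topology_def by blast
  qed
  ultimately show ?lhs by blast
qed

end
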